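(* Let $X$ be a finite graph, let $\mu$ be a measure on its vertex set with $\mu(x)>0$ for every vertex $x$, and let $G$ be a finite group acting on $X$ and preserving $\mu$. Let $A$ be a $G$-invariant, nonnegative, self-adjoint Laplacian on $L^2(X,\mu)$ of the form $$Au(x)=\frac{1}{\mu(x)}\sum_{y\sim x}c_{xy}\,(u(x)-u(y))$$ with positive conductances $c_{xy}=c_{yx}$ on the edges of $X$. Let $\{\pi_j\}$ be a complete set of inequivalent irreducible unitary representations of $G$, with dimensions $d_j$, and let $F\subset X$ be a fundamental domain for the $G$-action, with boundary $\partial F$ (as defined in the context). Then for every $j$ and every $\lambda$, $$\left|M_j(\lambda)-\frac{d_j^2}{\#G}\,M(\lambda)\right|\le \frac{d_j^2\,\#\partial F}{\mu(X)}.$$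
   Context: Functions are complex-valued; $X$ also denotes the vertex set, $y\sim x$ means that $x$ and $y$ are joined by an edge, $\mu(X)=\sum_{x}\mu(x)$, and $L^2(X,\mu)$ has inner product $\sum_x u(x)\overline{v(x)}\mu(x)$. $G$-invariance: for $f_g(x)=f(gx)$ one has $A(f_g)=(Af)_g$ for all $g\in G$ and all $f$; the action of $G$ preserves the graph structure, and $\mu(gx)=\mu(x)$. Isotypic subspaces: $G$ acts unitarily on $L^2(X,\mu)$ by translation, and $L^2_j(X)$ is the subspace of functions that transform according to $\pi_j$, i.e. the sum of all $G$-invariant subspaces on which the action of $G$ is equivalent to $\pi_j$. Then $L^2(X,\mu)=\bigoplus_j L^2_j(X)$ orthogonally, and each $L^2_j(X)$ is preserved by $A$. Spectral mass functions: $N(\lambda)$ is the number of eigenvalues of $A$ that are $\le\lambda$, counted with multiplicity, and $N_j(\lambda)$ is the number of eigenvalues $\le\lambda$, counted with multiplicity, of the restriction of $A$ to $L^2_j(X)$. Put $M(\lambda)=N(\lambda)/\mu(X)$ and $M_j(\lambda)=N_j(\lambda)/\mu(X)$. Fundamental domain: a subset $F\subset X$ with $X=\bigcup_{g\in G}gF$; the images $gF$ are not required to be disjoint. Its boundary $\partial F$ is the set of all points of $F$ that either lie in $gF$, or have an edge connecting to a point of $gF$, for some $g\in G$ that is not the identity. *)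

theory Defs
  imports
    "Jordan_Normal_Form.VS_Connect"
    "Jordan_Normal_Form.Schur_Decomposition"
    "Graph_Theory.Pair_Digraph"
    "HOL-Algebra.Group_Action"
    "HOL-Library.Function_Algebras"
begin

definition cscale :: "complex \<Rightarrow> ('x \<Rightarrow> complex) \<Rightarrow> 'x \<Rightarrow> complex" where
  "cscale a u = (\<lambda>x. a * u x)"

interpretation cfun: vector_space "cscale :: complex \<Rightarrow> ('x \<Rightarrow> complex) \<Rightarrow> 'x \<Rightarrow> complex"
  by unfold_locales (auto simp: cscale_def algebra_simps)

text \<open>
  A function on the vertex set \<open>S\<close> is represented by its extension by zero to the
  whole type, so that vanishing outside \<open>S\<close> picks out one representative.
\<close>

definition L2 :: "'x set \<Rightarrow> ('x \<Rightarrow> complex) set" where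
  "L2 S = {u. \<forall>x. x \<notin> S \<longrightarrow> u x = 0}"

definition L2_inner :: "'x set \<Rightarrow> ('x \<Rightarrow> real) \<Rightarrow> ('x \<Rightarrow> complex) \<Rightarrow> ('x \<Rightarrow> complex) \<Rightarrow> complex" where
  "L2_inner S \<mu> u v = (\<Sum>x\<in>S. u x * cnj (v x) * complex_of_real (\<mu> x))"

definition self_adjoint_on_L2 ::
    "'x set \<Rightarrow> ('x \<Rightarrow> real) \<Rightarrow> (('x \<Rightarrow> complex) \<Rightarrow> 'x \<Rightarrow> complex) \<Rightarrow> bool" where
  "self_adjoint_on_L2 S \<mu> A \<longleftrightarrow>
     (\<forall>u\<in>L2 S. \<forall>v\<in>L2 S. L2_inner S \<mu> (A u) v = L2_inner S \<mu> u (A v))"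

definition nonnegative_on_L2 ::
    "'x set \<Rightarrow> ('x \<Rightarrow> real) \<Rightarrow> (('x \<Rightarrow> complex) \<Rightarrow> 'x \<Rightarrow> complex) \<Rightarrow> bool" where
  "nonnegative_on_L2 S \<mu> A \<longleftrightarrow>
     (\<forall>u\<in>L2 S. L2_inner S \<mu> (A u) u \<in> \<real> \<and> Re (L2_inner S \<mu> (A u) u) \<ge> 0)"

definition graph_laplacian ::
    "'x pair_pre_digraph \<Rightarrow> ('x \<Rightarrow> real) \<Rightarrow> ('x \<Rightarrow> 'x \<Rightarrow> real) \<Rightarrow> ('x \<Rightarrow> complex) \<Rightarrow> 'x \<Rightarrow> complex" where
  "graph_laplacian X \<mu> c u =
     (\<lambda>x. if x \<in> pverts X
          then complex_of_real (1 / \<mu> x) *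
               (\<Sum>y \<in> {y. (x, y) \<in> parcs X}. complex_of_real (c x y) * (u x - u y))
          else 0)"

definition eigenspace_on ::
    "(('x \<Rightarrow> complex) \<Rightarrow> 'x \<Rightarrow> complex) \<Rightarrow> ('x \<Rightarrow> complex) set \<Rightarrow> real \<Rightarrow> ('x \<Rightarrow> complex) set" where
  "eigenspace_on A V r = {u \<in> V. A u = cscale (complex_of_real r) u}"

definition eigenvalues_on ::
    "(('x \<Rightarrow> complex) \<Rightarrow> 'x \<Rightarrow> complex) \<Rightarrow> ('x \<Rightarrow> complex) set \<Rightarrow> real set" where
  "eigenvalues_on A V = {r. \<exists>u\<in>eigenspace_on A V r. u \<noteq> 0}"

text \<open>
  Only real eigenvalues are considered and the multiplicity is the geometric one; for the
  restriction of a self-adjoint operator to an invariant subspace this is no restriction.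
\<close>

definition eigenvalue_count ::
    "(('x \<Rightarrow> complex) \<Rightarrow> 'x \<Rightarrow> complex) \<Rightarrow> ('x \<Rightarrow> complex) set \<Rightarrow> real \<Rightarrow> nat" where
  "eigenvalue_count A V lam =
     (\<Sum>r \<in> {r \<in> eigenvalues_on A V. r \<le> lam}. cfun.dim (eigenspace_on A V r))"

definition spectral_mass ::
    "'x set \<Rightarrow> ('x \<Rightarrow> real) \<Rightarrow> (('x \<Rightarrow> complex) \<Rightarrow> 'x \<Rightarrow> complex) \<Rightarrow> ('x \<Rightarrow> complex) set \<Rightarrow> real \<Rightarrow> real" where
  "spectral_mass S \<mu> A V lam = real (eigenvalue_count A V lam) / (\<Sum>x\<in>S. \<mu> x)"

definition unitary_group :: "nat \<Rightarrow> complex mat monoid" where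
  "unitary_group n =
     \<lparr> carrier = {U \<in> carrier_mat n n. U * mat_adjoint U = 1\<^sub>m n \<and> mat_adjoint U * U = 1\<^sub>m n},
       monoid.mult = (*), one = 1\<^sub>m n \<rparr>"

definition unitary_rep :: "('g, 'b) monoid_scheme \<Rightarrow> nat \<Rightarrow> ('g \<Rightarrow> complex mat) \<Rightarrow> bool" where
  "unitary_rep G n \<rho> \<longleftrightarrow> \<rho> \<in> hom G (unitary_group n)"

definition irreducible_rep :: "('g, 'b) monoid_scheme \<Rightarrow> nat \<Rightarrow> ('g \<Rightarrow> complex mat) \<Rightarrow> bool" where
  "irreducible_rep G n \<rho> \<longleftrightarrow>
     n > 0 \<and>
     (\<forall>W. VectorSpace.subspace class_ring W (module_vec TYPE(complex) n) \<and>
          (\<forall>g\<in>carrier G. \<forall>w\<in>W. \<rho> g *\<^sub>v w \<in> W)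
          \<longrightarrow> W = {0\<^sub>v n} \<or> W = carrier_vec n)"

definition equivalent_reps ::
    "('g, 'b) monoid_scheme \<Rightarrow> ('g \<Rightarrow> complex mat) \<Rightarrow> ('g \<Rightarrow> complex mat) \<Rightarrow> bool" where
  "equivalent_reps G \<rho> \<sigma> \<longleftrightarrow> (\<exists>P Q. \<forall>g\<in>carrier G. similar_mat_wit (\<rho> g) (\<sigma> g) P Q)"

definition complete_irreps ::
    "('g, 'b) monoid_scheme \<Rightarrow> 'j set \<Rightarrow> ('j \<Rightarrow> nat) \<Rightarrow> ('j \<Rightarrow> 'g \<Rightarrow> complex mat) \<Rightarrow> bool" where
  "complete_irreps G J d \<pi> \<longleftrightarrow>
     (\<forall>j\<in>J. unitary_rep G (d j) (\<pi> j) \<and> irreducible_rep G (d j) (\<pi> j)) \<and>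
     (\<forall>i\<in>J. \<forall>j\<in>J. i \<noteq> j \<longrightarrow> \<not> equivalent_reps G (\<pi> i) (\<pi> j)) \<and>
     (\<forall>n \<rho>. unitary_rep G n \<rho> \<and> irreducible_rep G n \<rho> \<longrightarrow>
        (\<exists>j\<in>J. equivalent_reps G \<rho> (\<pi> j)))"

definition preserves_graph ::
    "('g, 'b) monoid_scheme \<Rightarrow> 'x pair_pre_digraph \<Rightarrow> ('g \<Rightarrow> 'x \<Rightarrow> 'x) \<Rightarrow> bool" where
  "preserves_graph G X \<phi> \<longleftrightarrow>
     (\<forall>g\<in>carrier G. \<forall>x\<in>pverts X. \<forall>y\<in>pverts X.
        (\<phi> g x, \<phi> g y) \<in> parcs X \<longleftrightarrow> (x, y) \<in> parcs X)"

definition preserves_measure ::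
    "('g, 'b) monoid_scheme \<Rightarrow> 'x set \<Rightarrow> ('g \<Rightarrow> 'x \<Rightarrow> 'x) \<Rightarrow> ('x \<Rightarrow> real) \<Rightarrow> bool" where
  "preserves_measure G S \<phi> \<mu> \<longleftrightarrow> (\<forall>g\<in>carrier G. \<forall>x\<in>S. \<mu> (\<phi> g x) = \<mu> x)"

definition pullback :: "'x set \<Rightarrow> ('g \<Rightarrow> 'x \<Rightarrow> 'x) \<Rightarrow> 'g \<Rightarrow> ('x \<Rightarrow> complex) \<Rightarrow> 'x \<Rightarrow> complex" where
  "pullback S \<phi> g u = (\<lambda>x. if x \<in> S then u (\<phi> g x) else 0)"

definition invariant_operator ::
    "('g, 'b) monoid_scheme \<Rightarrow> 'x set \<Rightarrow> ('g \<Rightarrow> 'x \<Rightarrow> 'x) \<Rightarrow> (('x \<Rightarrow> complex) \<Rightarrow> 'x \<Rightarrow> complex) \<Rightarrow> bool" where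
  "invariant_operator G S \<phi> A \<longleftrightarrow>
     (\<forall>g\<in>carrier G. \<forall>u\<in>L2 S. A (pullback S \<phi> g u) = pullback S \<phi> g (A u))"

text \<open>
  Translation uses the inverse, \<open>(g \<cdot> u)(x) = u (g\<inverse> x)\<close>, so that it is a left action,
  i.e. a representation of \<open>G\<close> (\<^const>\<open>pullback\<close> itself is a right action).
\<close>

definition translation ::
    "('g, 'b) monoid_scheme \<Rightarrow> 'x set \<Rightarrow> ('g \<Rightarrow> 'x \<Rightarrow> 'x) \<Rightarrow> 'g \<Rightarrow> ('x \<Rightarrow> complex) \<Rightarrow> 'x \<Rightarrow> complex" where
  "translation G S \<phi> g = pullback S \<phi> (inv\<^bsub>G\<^esub> g)"

definition transforms_according_to ::
    "('g, 'b) monoid_scheme \<Rightarrow> 'x set \<Rightarrow> ('g \<Rightarrow> 'x \<Rightarrow> 'x) \<Rightarrow> ('x \<Rightarrow> complex) set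
      \<Rightarrow> nat \<Rightarrow> ('g \<Rightarrow> complex mat) \<Rightarrow> bool" where
  "transforms_according_to G S \<phi> W n \<rho> \<longleftrightarrow>
     (\<exists>\<Phi>. bij_betw \<Phi> (carrier_vec n) W \<and>
          (\<forall>v\<in>carrier_vec n. \<forall>w\<in>carrier_vec n. \<Phi> (v + w) = \<Phi> v + \<Phi> w) \<and>
          (\<forall>a. \<forall>v\<in>carrier_vec n. \<Phi> (a \<cdot>\<^sub>v v) = cscale a (\<Phi> v)) \<and>
          (\<forall>g\<in>carrier G. \<forall>v\<in>carrier_vec n. \<Phi> (\<rho> g *\<^sub>v v) = translation G S \<phi> g (\<Phi> v)))"

definition isotypic_subspace ::
    "('g, 'b) monoid_scheme \<Rightarrow> 'x set \<Rightarrow> ('g \<Rightarrow> 'x \<Rightarrow> 'x) \<Rightarrow> nat \<Rightarrow> ('g \<Rightarrow> complex mat)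
      \<Rightarrow> ('x \<Rightarrow> complex) set" where
  "isotypic_subspace G S \<phi> n \<rho> =
     cfun.span (\<Union> {W. W \<subseteq> L2 S \<and> cfun.subspace W \<and>
                       (\<forall>g\<in>carrier G. translation G S \<phi> g ` W \<subseteq> W) \<and>
                       transforms_according_to G S \<phi> W n \<rho>})"

definition fundamental_domain ::
    "('g, 'b) monoid_scheme \<Rightarrow> 'x set \<Rightarrow> ('g \<Rightarrow> 'x \<Rightarrow> 'x) \<Rightarrow> 'x set \<Rightarrow> bool" where
  "fundamental_domain G S \<phi> F \<longleftrightarrow> F \<subseteq> S \<and> S = (\<Union>g\<in>carrier G. \<phi> g ` F)"

definition domain_boundary ::
    "('g, 'b) monoid_scheme \<Rightarrow> 'x pair_pre_digraph \<Rightarrow> ('g \<Rightarrow> 'x \<Rightarrow> 'x) \<Rightarrow> 'x set \<Rightarrow> 'x set" where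
  "domain_boundary G X \<phi> F =
     {x \<in> F. \<exists>g\<in>carrier G. g \<noteq> \<one>\<^bsub>G\<^esub> \<and>
        (x \<in> \<phi> g ` F \<or> (\<exists>y\<in>\<phi> g ` F. (x, y) \<in> parcs X))}"

end

theory Submission
  imports Defs
begin

text \<open>
  Let \<open>F0\<close> be \<open>F\<close> without its boundary, and let \<open>k\<close> be the number of eigenvalues at most
  \<open>\<lambda>\<close> of the Dirichlet Laplacian of \<open>F0\<close>. The translates of \<open>F0\<close> are disjoint and no edge joins
  two of them, so on functions vanishing on all translates of the boundary the quadratic form of
  \<open>A\<close> splits into copies of the Dirichlet form, one for each group element.

  Let \<open>V\<close> be \<open>L\<^sup>2\<close> or an isotypic subspace, and let \<open>D\<close> be the dimension of the space \<open>C\<close> of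
  functions \<open>g \<mapsto> u (g\<inverse> x)\<close> with \<open>u \<in> V\<close>: the order of \<open>G\<close>, or \<open>d\<^sup>2\<close> by the orthogonality of
  matrix coefficients. Tensoring \<open>C\<close> with the Dirichlet eigenfunctions up to \<open>\<lambda>\<close> gives a
  \<open>D k\<close>-dimensional subspace of \<open>V\<close> on which the form is at most \<open>\<lambda>\<close>. Conversely, annihilating all
  translates of a linear functional costs at most \<open>D\<close> conditions on \<open>V\<close>, so annihilating the values
  on the boundary and the components along those eigenfunctions costs at most \<open>D (k + #\<partial>F)\<close>, after
  which the form exceeds \<open>\<lambda>\<close>. Hence \<open>D k \<le> N\<^sub>V(\<lambda>) \<le> D (k + #\<partial>F)\<close>, and the theorem follows by
  comparing the two choices of \<open>V\<close>.
\<close>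

section \<open>Eigenbases of symmetric operators\<close>

text \<open>Gaussian elimination, by induction on the equations: an equation with a nonzero
  coefficient eliminates one unknown, and one without imposes nothing. The dimension counts in the
  two eigenvalue estimates are made by this lemma, with explicit coefficient vectors instead of
  subspaces.\<close>

lemma homogeneous_system_nontrivial:
  fixes M :: "'i \<Rightarrow> 'k \<Rightarrow> 'a::field"
  assumes "finite I" "finite K" "card I < card K"
  shows "\<exists>a. (\<exists>k\<in>K. a k \<noteq> 0) \<and> (\<forall>i\<in>I. (\<Sum>k\<in>K. M i k * a k) = 0)"
  using assms
proof (induction I arbitrary: K M rule: finite_induct)
  case empty
  then have "K \<noteq> {}" by auto
  then show ?case by (intro exI[of _ "\<lambda>_. 1"]) auto
next
  case (insert i I)
  show ?case
  proof (cases "\<forall>k\<in>K. M i k = 0")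
    case True
    have "card I < card K" using insert by simp
    from insert.IH[OF insert.prems(1) this, of M] True show ?thesis
      by auto
  next
    case False
    then obtain p where p: "p \<in> K" "M i p \<noteq> 0" by auto
    have c: "card I < card (K - {p})" using insert p by simp
    obtain a where a: "\<exists>k\<in>K-{p}. a k \<noteq> 0"
      "\<forall>j\<in>I. (\<Sum>k\<in>K-{p}. (M j k - M j p * M i k / M i p) * a k) = 0"
      using insert.IH[OF _ c, of "\<lambda>j k. M j k - M j p * M i k / M i p"] insert.prems by auto
    \<comment> \<open>The value at the pivot \<open>p\<close> is the one forced by equation
      \<open>i\<close>; the reduced equations then give back the original ones.\<close>
    define b where "b = a(p := - (\<Sum>k\<in>K-{p}. M i k * a k) / M i p)"
    have split: "(\<Sum>k\<in>K. M j k * b k) = M j p * b p + (\<Sum>k\<in>K-{p}. M j k * a k)" for j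
      using p insert.prems by (subst sum.remove[of K p]) (auto simp: b_def intro!: sum.cong)
    have "(\<Sum>k\<in>K. M j k * b k) = 0" if "j \<in> insert i I" for j
    proof (cases "j = i")
      case True
      then show ?thesis using p by (subst split) (simp add: b_def)
    next
      case False
      with that a have "(\<Sum>k\<in>K-{p}. (M j k - M j p * M i k / M i p) * a k) = 0" by auto
      then have "(\<Sum>k\<in>K-{p}. M j k * a k) = M j p / M i p * (\<Sum>k\<in>K-{p}. M i k * a k)"
        by (simp add: algebra_simps sum_subtractf sum_distrib_left)
      then show ?thesis using p by (subst split) (simp add: b_def)
    qed
    moreover have "\<exists>k\<in>K. b k \<noteq> 0" using a(1) by (auto simp: b_def)
    ultimately show ?thesis by blast
  qed
qed

lemma sum_fun_apply: "(\<Sum>i\<in>I. f i) x = (\<Sum>i\<in>I. f i x)"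
  for f :: "'i \<Rightarrow> 'x \<Rightarrow> 'a::comm_monoid_add"
  by (induction I rule: infinite_finite_induct) auto

lemma cscale_apply [simp]: "cscale a u x = a * u x"
  by (simp add: cscale_def)

section \<open>Polynomials of a linear operator and existence of eigenvectors\<close>

abbreviation clinear :: "(('x \<Rightarrow> complex) \<Rightarrow> 'y \<Rightarrow> complex) \<Rightarrow> bool" where
  "clinear \<equiv> Vector_Spaces.linear cscale cscale"

lemma clinearI:
  assumes "\<And>u v. A (u + v) = A u + A v" "\<And>a u. A (cscale a u) = cscale a (A u)"
  shows "clinear A"
  using assms by unfold_locales

lemma clinear_add: "clinear A \<Longrightarrow> A (u + v) = A u + A v"
  and clinear_scale: "clinear A \<Longrightarrow> A (cscale a u) = cscale a (A u)"
  and clinear_zero: "clinear A \<Longrightarrow> A 0 = 0"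
  and clinear_sum: "clinear A \<Longrightarrow> A (\<Sum>i\<in>I. f i) = (\<Sum>i\<in>I. A (f i))"
  by (simp_all add: Vector_Spaces.linear_iff_module_hom module_hom.add module_hom.scale
      module_hom.zero module_hom.sum)

definition poly_apply ::
    "complex poly \<Rightarrow> (('x \<Rightarrow> complex) \<Rightarrow> 'x \<Rightarrow> complex) \<Rightarrow> ('x \<Rightarrow> complex) \<Rightarrow> 'x \<Rightarrow> complex" where
  "poly_apply p A v = (\<Sum>i\<le>degree p. cscale (coeff p i) ((A ^^ i) v))"

text \<open>Padding with zero coefficients lets polynomials of different degrees be compared over a
  common summation range.\<close>

lemma poly_apply_altdef:
  assumes "degree p \<le> N"
  shows "poly_apply p A v = (\<Sum>i\<le>N. cscale (coeff p i) ((A ^^ i) v))"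
  unfolding poly_apply_def
  by (rule sum.mono_neutral_left) (use assms in \<open>auto simp: coeff_eq_0 fun_eq_iff\<close>)

lemma poly_apply_linear_factor:
  assumes "clinear A"
  shows "poly_apply ([:-z, 1:] * q) A v = A (poly_apply q A v) - cscale z (poly_apply q A v)"
proof -
  let ?N = "degree q"
  have eq: "[:-z, 1:] * q = smult (-z) q + pCons 0 q" by simp
  have "degree ([:-z, 1:] * q) \<le> Suc ?N"
    by (rule order.trans[OF degree_mult_le]) simp
  then have "poly_apply ([:-z, 1:] * q) A v =
      (\<Sum>i\<le>Suc ?N. cscale (coeff (pCons 0 q) i) ((A ^^ i) v) - cscale z (cscale (coeff q i) ((A ^^ i) v)))"
    unfolding eq by (subst poly_apply_altdef, assumption)
      (auto intro!: sum.cong simp: fun_eq_iff algebra_simps)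
  also have "\<dots> = (\<Sum>i\<le>Suc ?N. cscale (coeff (pCons 0 q) i) ((A ^^ i) v))
      - cscale z (poly_apply q A v)"
    by (subst poly_apply_altdef[of q "Suc ?N"], simp)
      (simp only: sum_subtractf cfun.scale_sum_right)
  also have "(\<Sum>i\<le>Suc ?N. cscale (coeff (pCons 0 q) i) ((A ^^ i) v)) = A (poly_apply q A v)"
    unfolding poly_apply_def clinear_sum[OF assms] clinear_scale[OF assms]
    by (subst sum.atMost_Suc_shift) (simp add: fun_eq_iff sum_fun_apply)
  finally show ?thesis .
qed

lemma poly_apply_mem:
  assumes "cfun.subspace V" "A ` V \<subseteq> V" "v \<in> V"
  shows "poly_apply p A v \<in> V"
proof -
  have "(A ^^ i) v \<in> V" for i by (induction i) (use assms in auto)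
  then show ?thesis unfolding poly_apply_def
    by (intro cfun.subspace_sum cfun.subspace_scale assms) auto
qed

text \<open>Over the complex numbers \<open>p\<close> has a linear factor,
  \<open>p = [:-z, 1:] * q\<close>. Either q(A)v is zero and the smaller polynomial \<open>q\<close>
  takes over, or q(A)v is itself an eigenvector with eigenvalue \<open>z\<close>.\<close>

lemma eigenvector_of_annihilator:
  assumes V: "cfun.subspace V" "A ` V \<subseteq> V" "v \<in> V" and A: "clinear A"
    and "v \<noteq> 0" "p \<noteq> 0" "poly_apply p A v = 0"
  shows "\<exists>z. \<exists>w\<in>V. w \<noteq> 0 \<and> A w = cscale z w"
  using assms(6,7)
proof (induction "degree p" arbitrary: p)
  case 0
  then obtain a where "p = [:a:]" by (metis degree_eq_zeroE)
  with 0 \<open>v \<noteq> 0\<close> show ?case by (auto simp: poly_apply_def fun_eq_iff)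
next
  case (Suc n)
  then have "\<not> constant (poly p)" by (simp add: constant_degree)
  then obtain z where "poly p z = 0" using fundamental_theorem_of_algebra by blast
  then obtain q where q: "p = [:-z, 1:] * q" by (auto simp: poly_eq_0_iff_dvd dvd_def)
  with Suc have "q \<noteq> 0" by auto
  then have "degree p = Suc (degree q)" unfolding q by (subst degree_mult_eq) auto
  with Suc have "n = degree q" by simp
  show ?case
  proof (cases "poly_apply q A v = 0")
    case True
    with Suc.hyps(1)[OF \<open>n = degree q\<close> \<open>q \<noteq> 0\<close>] show ?thesis by simp
  next
    case False
    have "A (poly_apply q A v) - cscale z (poly_apply q A v) = 0"
      using Suc.prems(2) unfolding q poly_apply_linear_factor[OF A] .
    then show ?thesis using False poly_apply_mem[OF V] by (intro exI bexI[of _ "poly_apply q A v"]) auto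
  qed
qed

text \<open>The \<open>card S + 1\<close> iterates of \<open>A\<close> on \<open>v\<close> are
  functions supported on \<open>S\<close>, hence linearly dependent. Such a dependence is a nonzero
  polynomial annihilating \<open>v\<close>.\<close>

lemma eigenvector_exists:
  assumes "finite S" "V \<subseteq> L2 S" "cfun.subspace V" "A ` V \<subseteq> V" "clinear A" "v \<in> V" "v \<noteq> 0"
  shows "\<exists>z. \<exists>w\<in>V. w \<noteq> 0 \<and> A w = cscale z w"
proof -
  have it: "(A ^^ i) v \<in> V" for i by (induction i) (use assms in auto)
  obtain a where a: "\<exists>k\<in>{..card S}. a k \<noteq> 0"
    "\<forall>x\<in>S. (\<Sum>k\<le>card S. (A ^^ k) v x * a k) = 0"
    using homogeneous_system_nontrivial[OF \<open>finite S\<close>, of "{..card S}" "\<lambda>x k. (A ^^ k) v x"]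
    by auto
  define p where "p = (\<Sum>k\<le>card S. monom (a k) k)"
  have coeff: "coeff p k = (if k \<le> card S then a k else 0)" for k
    unfolding p_def coeff_sum by (auto simp: coeff_monom if_distrib cong: if_cong)
  then have "p \<noteq> 0" using a(1) by (metis atMost_iff coeff_0)
  moreover have "degree p \<le> card S" by (rule degree_le) (simp add: coeff)
  then have "poly_apply p A v = 0"
    using a(2) it assms(2)
    by (auto simp: poly_apply_altdef fun_eq_iff sum_fun_apply coeff mult.commute L2_def subset_iff)
  ultimately show ?thesis using eigenvector_of_annihilator assms by blast
qed

section \<open>The weighted inner product and orthonormal families\<close>

locale weighted_set =
  fixes S :: "'x set" and \<mu> :: "'x \<Rightarrow> real"
  assumes finite_S: "finite S" and weight_pos: "x \<in> S \<Longrightarrow> \<mu> x > 0"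
begin

abbreviation ip :: "('x \<Rightarrow> complex) \<Rightarrow> ('x \<Rightarrow> complex) \<Rightarrow> complex" where
  "ip \<equiv> L2_inner S \<mu>"

lemma ip_add_left: "ip (u + v) w = ip u w + ip v w"
  and ip_diff_left: "ip (u - v) w = ip u w - ip v w"
  and ip_scale_left: "ip (cscale a u) w = a * ip u w"
  and ip_scale_right: "ip u (cscale a w) = cnj a * ip u w"
  and ip_zero_left [simp]: "ip 0 w = 0"
  and ip_zero_right [simp]: "ip w 0 = 0"
  by (simp_all add: L2_inner_def algebra_simps sum.distrib sum_subtractf sum_distrib_left)

lemma ip_sum_left: "ip (\<Sum>i\<in>I. f i) w = (\<Sum>i\<in>I. ip (f i) w)"
  by (simp add: L2_inner_def sum_fun_apply sum_distrib_right) (rule sum.swap)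

lemma ip_cnj: "ip v u = cnj (ip u v)"
  by (simp add: L2_inner_def mult_ac)

lemma ip_sum_right: "ip w (\<Sum>i\<in>I. f i) = (\<Sum>i\<in>I. ip w (f i))"
  by (subst ip_cnj, subst ip_sum_left, simp, simp add: ip_cnj[symmetric])

lemma ip_self: "ip u u = complex_of_real (\<Sum>x\<in>S. (cmod (u x))\<^sup>2 * \<mu> x)"
  by (simp add: L2_inner_def complex_norm_square[symmetric] del: of_real_power)

lemma ip_self_eq_0_iff: "u \<in> L2 S \<Longrightarrow> ip u u = 0 \<longleftrightarrow> u = 0"
proof
  assume u: "u \<in> L2 S" and "ip u u = 0"
  then have "(\<Sum>x\<in>S. (cmod (u x))\<^sup>2 * \<mu> x) = 0" unfolding ip_self by (simp only: of_real_eq_0_iff)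
  then have "\<forall>x\<in>S. (cmod (u x))\<^sup>2 * \<mu> x = 0"
    by (subst (asm) sum_nonneg_eq_0_iff) (auto simp: finite_S intro!: mult_nonneg_nonneg less_imp_le[OF weight_pos])
  then have "\<forall>x\<in>S. u x = 0" using weight_pos by fastforce
  with u show "u = 0" by (auto simp: L2_def fun_eq_iff)
qed auto

lemma ip_self_real: "ip u u = complex_of_real (Re (ip u u))"
  unfolding ip_self by simp

lemma ip_self_pos: "u \<in> L2 S \<Longrightarrow> u \<noteq> 0 \<Longrightarrow> Re (ip u u) > 0"
proof -
  assume "u \<in> L2 S" "u \<noteq> 0"
  then have "Re (ip u u) \<noteq> 0" using ip_self_eq_0_iff ip_self_real by (metis of_real_0)
  moreover have "Re (ip u u) \<ge> 0"
    unfolding ip_self Re_complex_of_real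
    by (intro sum_nonneg mult_nonneg_nonneg less_imp_le[OF weight_pos]) auto
  ultimately show ?thesis by simp
qed

definition orthonormal :: "('x \<Rightarrow> complex) set \<Rightarrow> bool" where
  "orthonormal B \<longleftrightarrow> (\<forall>b\<in>B. \<forall>b'\<in>B. ip b b' = (if b = b' then 1 else 0))"

lemma ip_orthonormal_expansion:
  assumes "orthonormal B" "finite B" "b \<in> B"
  shows "ip (\<Sum>b\<in>B. cscale (a b) b) b = a b"
proof -
  have "ip (\<Sum>b\<in>B. cscale (a b) b) b = (\<Sum>b'\<in>B. if b' = b then a b' else 0)"
    unfolding ip_sum_left ip_scale_left
    by (rule sum.cong) (use assms in \<open>auto simp: orthonormal_def\<close>)
  then show ?thesis using assms by simp
qed

text \<open>A larger family would satisfy a nontrivial linear relation, and pairing the relation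
  with each member shows that its coefficients vanish. The bound guarantees a maximal family in
  \<open>eigenbasis_exists\<close>.\<close>

lemma orthonormal_card_le:
  assumes "orthonormal B" "finite B" "B \<subseteq> L2 S"
  shows "card B \<le> card S"
proof (rule ccontr)
  assume "\<not> ?thesis"
  then obtain a where a: "\<exists>b\<in>B. a b \<noteq> 0" "\<forall>x\<in>S. (\<Sum>b\<in>B. b x * a b) = 0"
    using homogeneous_system_nontrivial[OF finite_S \<open>finite B\<close>, of "\<lambda>x b. b x"] by auto
  have "(\<Sum>b\<in>B. cscale (a b) b) x = 0" for x
  proof (cases "x \<in> S")
    case True then show ?thesis using a(2) by (simp add: sum_fun_apply mult.commute)
  next
    case False then show ?thesis using assms(3)
      by (auto simp: sum_fun_apply L2_def intro!: sum.neutral)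
  qed
  then have "(\<Sum>b\<in>B. cscale (a b) b) = 0" by (simp add: fun_eq_iff)
  then have "a b = 0" if "b \<in> B" for b
    using ip_orthonormal_expansion[OF assms(1,2) that, of a] by simp
  with a(1) show False by auto
qed

text \<open>Completeness is expressed by the Fourier expansion rather than by a span, which makes
  Parseval's identity immediate. Since \<open>ev\<close> is attached to basis vectors,
  multiplicities become numbers of basis vectors.\<close>

definition eigenbasis ::
    "(('x \<Rightarrow> complex) \<Rightarrow> 'x \<Rightarrow> complex) \<Rightarrow> ('x \<Rightarrow> complex) set \<Rightarrow> ('x \<Rightarrow> complex) set
      \<Rightarrow> (('x \<Rightarrow> complex) \<Rightarrow> real) \<Rightarrow> bool" where
  "eigenbasis A V B ev \<longleftrightarrow> finite B \<and> B \<subseteq> V \<and> orthonormal B \<and>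
     (\<forall>u\<in>V. u = (\<Sum>b\<in>B. cscale (ip u b) b)) \<and>
     (\<forall>b\<in>B. A b = cscale (complex_of_real (ev b)) b)"

lemma eigenvalue_real:
  assumes "ip (A w) w = ip w (A w)" "w \<in> L2 S" "w \<noteq> 0" "A w = cscale z w"
  shows "z = complex_of_real (Re z)"
proof -
  have "z * ip w w = cnj z * ip w w"
    using assms(1) by (simp only: assms(4) ip_scale_left ip_scale_right)
  then have "z = cnj z" using ip_self_eq_0_iff assms(2,3) by (metis mult_cancel_right)
  then show ?thesis by (simp add: complex_eq_iff)
qed

text \<open>Take an orthonormal family of eigenvectors in \<open>V\<close> of maximal size. By
  symmetry its orthogonal complement \<open>V'\<close> is invariant under \<open>A\<close>. A
  nonzero \<open>V'\<close> would contain an eigenvector, with real eigenvalue, and normalising it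
  would enlarge the family; so \<open>V'\<close> is zero and the family is complete.\<close>

theorem eigenbasis_exists:
  assumes V: "cfun.subspace V" "V \<subseteq> L2 S" "A ` V \<subseteq> V" and A: "clinear A"
    and sym: "\<And>u v. u \<in> V \<Longrightarrow> v \<in> V \<Longrightarrow> ip (A u) v = ip u (A v)"
  shows "\<exists>B ev. eigenbasis A V B ev"
proof -
  define P where "P B \<longleftrightarrow> finite B \<and> B \<subseteq> V \<and> orthonormal B \<and>
    (\<forall>b\<in>B. \<exists>r. A b = cscale (complex_of_real r) b)" for B
  have "P {}" by (simp add: P_def orthonormal_def)
  moreover have "\<forall>B. P B \<longrightarrow> card B < Suc (card S)"
    using V orthonormal_card_le by (auto simp: P_def less_Suc_eq_le)
  ultimately obtain B where B: "P B" and max: "\<And>B'. P B' \<Longrightarrow> card B' \<le> card B"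
    using ex_has_greatest_nat[of P "{}" card] by metis
  then have fin: "finite B" and BV: "B \<subseteq> V" and orth: "orthonormal B" by (auto simp: P_def)
  obtain ev where ev: "\<And>b. b \<in> B \<Longrightarrow> A b = cscale (complex_of_real (ev b)) b"
    using B by (metis P_def)
  define V' where "V' = {v \<in> V. \<forall>b\<in>B. ip v b = 0}"
  have sub: "cfun.subspace V'"
    using V(1) by (auto simp: V'_def cfun.subspace_def ip_add_left ip_scale_left)
  have "A ` V' \<subseteq> V'"
    using V BV by (auto simp: V'_def sym ev ip_scale_right subset_iff)
  have "v = 0" if v: "v \<in> V'" for v
  proof (rule ccontr)
    assume "v \<noteq> 0"
    then obtain z w where w: "w \<in> V'" "w \<noteq> 0" "A w = cscale z w"
      using eigenvector_exists[OF finite_S _ sub \<open>A ` V' \<subseteq> V'\<close> A v] V V'_def by blast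
    then have wV: "w \<in> V" "w \<in> L2 S" using V V'_def by auto
    have z: "z = complex_of_real (Re z)"
      using eigenvalue_real[of A w z, OF sym[OF wV(1) wV(1)] wV(2) w(2,3)] .
    define e where "e = cscale (complex_of_real (1 / sqrt (Re (ip w w)))) w"
    have "ip e e = 1"
    proof -
      have "Re (ip w w) > 0" using ip_self_pos wV w by blast
      then show ?thesis unfolding e_def ip_scale_left ip_scale_right
        by (subst ip_self_real[of w]) (simp flip: of_real_mult of_real_divide add: real_sqrt_mult_self)
    qed
    have eV: "e \<in> V'" unfolding e_def by (intro cfun.subspace_scale sub w)
    have e0: "ip e b = 0" "ip b e = 0" if "b \<in> B" for b
      using eV that ip_cnj[of b e] by (auto simp: V'_def)
    have "A e = cscale z e" using w by (simp add: e_def clinear_scale[OF A] fun_eq_iff)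
    have "e \<notin> B" using e0 \<open>ip e e = 1\<close> by force
    have "P (insert e B)"
      using B eV e0 \<open>ip e e = 1\<close> \<open>A e = cscale z e\<close> z
      by (auto simp: P_def orthonormal_def V'_def)
    from max[OF this] \<open>e \<notin> B\<close> fin show False by simp
  qed note triv = this
  have "u = (\<Sum>b\<in>B. cscale (ip u b) b)" if "u \<in> V" for u
  proof -
    have "u - (\<Sum>b\<in>B. cscale (ip u b) b) \<in> V'"
      unfolding V'_def using that BV
      by (auto simp: ip_diff_left ip_orthonormal_expansion[OF orth fin]
          intro!: cfun.subspace_diff cfun.subspace_sum cfun.subspace_scale V)
    from triv[OF this] show ?thesis by simp
  qed
  then have "eigenbasis A V B ev"
    using fin BV orth ev by (auto simp: eigenbasis_def)
  then show ?thesis by blast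
qed

section \<open>Quadratic form bounds and counting eigenvalues\<close>

lemma eigenbasis_parseval:
  assumes "eigenbasis A V B ev" "u \<in> V" "clinear A"
  shows "ip u u = complex_of_real (\<Sum>b\<in>B. (cmod (ip u b))\<^sup>2)"
    and "ip (A u) u = complex_of_real (\<Sum>b\<in>B. ev b * (cmod (ip u b))\<^sup>2)"
proof -
  have u: "u = (\<Sum>b\<in>B. cscale (ip u b) b)"
    and Ab: "\<And>b. b \<in> B \<Longrightarrow> A b = cscale (complex_of_real (ev b)) b"
    using assms by (auto simp: eigenbasis_def)
  have *: "ip v u = (\<Sum>b\<in>B. cnj (ip u b) * ip v b)" for v
    by (subst u) (simp add: ip_sum_right ip_scale_right)
  show "ip u u = complex_of_real (\<Sum>b\<in>B. (cmod (ip u b))\<^sup>2)"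
    by (subst *) (simp add: complex_norm_square mult.commute del: of_real_power)
  have "A u = (\<Sum>b\<in>B. A (cscale (ip u b) b))"
    by (subst u) (simp add: clinear_sum[OF assms(3)])
  also have "\<dots> = (\<Sum>b\<in>B. cscale (complex_of_real (ev b) * ip u b) b)"
    by (intro sum.cong) (auto simp: clinear_scale[OF assms(3)] Ab fun_eq_iff)
  finally have Au: "A u = (\<Sum>b\<in>B. cscale (complex_of_real (ev b) * ip u b) b)" .
  have "ip (A u) b = complex_of_real (ev b) * ip u b" if "b \<in> B" for b
    unfolding Au using assms that
    by (subst ip_orthonormal_expansion) (auto simp: eigenbasis_def)
  then show "ip (A u) u = complex_of_real (\<Sum>b\<in>B. ev b * (cmod (ip u b))\<^sup>2)"
    by (subst *) (simp add: complex_norm_square mult_ac del: of_real_power)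
qed

lemma eigenbasis_form_le:
  assumes "eigenbasis A V B ev" "u \<in> V" "clinear A"
    and "\<And>b. b \<in> B \<Longrightarrow> ev b > lam \<Longrightarrow> ip u b = 0"
  shows "Re (ip (A u) u) \<le> lam * Re (ip u u)"
  unfolding eigenbasis_parseval[OF assms(1-3)] Re_complex_of_real sum_distrib_left
proof (rule sum_mono)
  fix b assume "b \<in> B"
  with assms(4) show "ev b * (cmod (ip u b))\<^sup>2 \<le> lam * (cmod (ip u b))\<^sup>2"
    by (cases "ev b \<le> lam") (auto intro: mult_right_mono)
qed

text \<open>By Parseval the comparison is termwise. Strictness comes from one nonzero component of
  \<open>u\<close>, which can only belong to an eigenvalue above \<open>lam\<close>.\<close>

lemma eigenbasis_form_gt:
  assumes "eigenbasis A V B ev" "u \<in> V" "clinear A"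
    and zero: "\<And>b. b \<in> B \<Longrightarrow> ev b \<le> lam \<Longrightarrow> ip u b = 0" and "u \<noteq> 0"
  shows "lam * Re (ip u u) < Re (ip (A u) u)"
proof -
  have "\<exists>b\<in>B. ip u b \<noteq> 0"
  proof (rule ccontr)
    assume "\<not> ?thesis"
    then have "(\<Sum>b\<in>B. cscale (ip u b) b) = 0" by (intro sum.neutral) (auto simp: fun_eq_iff)
    moreover have "u = (\<Sum>b\<in>B. cscale (ip u b) b)" using assms by (simp add: eigenbasis_def)
    ultimately show False using \<open>u \<noteq> 0\<close> by simp
  qed
  then obtain b where b: "b \<in> B" "ip u b \<noteq> 0" by blast
  show ?thesis
    unfolding eigenbasis_parseval[OF assms(1-3)] Re_complex_of_real sum_distrib_left
  proof (rule sum_strict_mono_ex1)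
    show "finite B" using assms by (simp add: eigenbasis_def)
    show "\<forall>b\<in>B. lam * (cmod (ip u b))\<^sup>2 \<le> ev b * (cmod (ip u b))\<^sup>2"
    proof
      fix b assume "b \<in> B"
      with zero show "lam * (cmod (ip u b))\<^sup>2 \<le> ev b * (cmod (ip u b))\<^sup>2"
        by (cases "ev b \<le> lam") (auto intro: mult_right_mono)
    qed
    have "lam < ev b" using zero b by force
    with b show "\<exists>b\<in>B. lam * (cmod (ip u b))\<^sup>2 < ev b * (cmod (ip u b))\<^sup>2"
      by (intro bexI[of _ b] mult_strict_right_mono) auto
  qed
qed

text \<open>Each eigenspace is spanned by the basis vectors carrying its eigenvalue, so its
  dimension is their number. Summing over the eigenvalues counts every basis vector with
  \<open>ev b \<le> lam\<close> once.\<close>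

lemma eigenbasis_count:
  assumes eb: "eigenbasis A V B ev" and V: "cfun.subspace V" and A: "clinear A"
    and sym: "\<And>u v. u \<in> V \<Longrightarrow> v \<in> V \<Longrightarrow> ip (A u) v = ip u (A v)"
  shows "eigenvalue_count A V lam = card {b\<in>B. ev b \<le> lam}"
proof -
  have fin: "finite B" and BV: "B \<subseteq> V" and orth: "orthonormal B"
    and Ab: "\<And>b. b \<in> B \<Longrightarrow> A b = cscale (complex_of_real (ev b)) b"
    and expand: "\<And>u. u \<in> V \<Longrightarrow> u = (\<Sum>b\<in>B. cscale (ip u b) b)"
    using eb unfolding eigenbasis_def by auto
  have indep: "cfun.independent C" if "C \<subseteq> B" for C
  proof -
    have o: "orthonormal C" "finite C" using that orth fin by (auto simp: orthonormal_def subset_iff intro: finite_subset)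
    show ?thesis
      using ip_orthonormal_expansion[OF o] o(2)
      by (auto simp: cfun.dependent_finite) (metis ip_zero_left)
  qed
  have span: "eigenspace_on A V r = cfun.span {b\<in>B. ev b = r}" for r
  proof (intro equalityI subsetI)
    fix u assume "u \<in> eigenspace_on A V r"
    then have u: "u \<in> V" "A u = cscale (complex_of_real r) u" by (auto simp: eigenspace_on_def)
    \<comment> \<open>Eigenvectors for different eigenvalues are orthogonal:
      \<open>ip (A u) b\<close> and \<open>ip u (A b)\<close> agree, but carry the factors
      \<open>r\<close> and \<open>ev b\<close>.\<close>
    have *: "ip u b = 0" if "b \<in> B" "ev b \<noteq> r" for b
    proof -
      have "of_real r * ip u b = of_real (ev b) * ip u b"
        using sym[of u b] u that BV Ab by (auto simp: ip_scale_left ip_scale_right)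
      with that show ?thesis by simp
    qed
    have "u = (\<Sum>b\<in>{b\<in>B. ev b = r}. cscale (ip u b) b)"
      by (subst expand[OF u(1)], rule sum.mono_neutral_right)
        (use fin * in \<open>auto simp: fun_eq_iff\<close>)
    then show "u \<in> cfun.span {b\<in>B. ev b = r}"
      by (metis (lifting) cfun.span_sum cfun.span_scale cfun.span_base)
  next
    fix u assume "u \<in> cfun.span {b\<in>B. ev b = r}"
    moreover have "cfun.subspace (eigenspace_on A V r)"
      using V by (auto simp: cfun.subspace_def eigenspace_on_def clinear_add[OF A]
          clinear_scale[OF A] clinear_zero[OF A] cfun.scale_right_distrib mult.commute)
    moreover have "{b\<in>B. ev b = r} \<subseteq> eigenspace_on A V r"
      using BV Ab by (auto simp: eigenspace_on_def)
    ultimately show "u \<in> eigenspace_on A V r" using cfun.span_minimal by blast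
  qed
  have dim: "cfun.dim (eigenspace_on A V r) = card {b\<in>B. ev b = r}" for r
    unfolding span by (rule cfun.dim_span_eq_card_independent) (intro indep, auto)
  have evs: "eigenvalues_on A V = ev ` B"
  proof (intro equalityI subsetI)
    fix r assume "r \<in> eigenvalues_on A V"
    then obtain u where "u \<in> cfun.span {b\<in>B. ev b = r}" "u \<noteq> 0"
      by (auto simp: eigenvalues_on_def span)
    then have "{b\<in>B. ev b = r} \<noteq> {}" by (metis cfun.span_empty singletonD)
    then show "r \<in> ev ` B" by auto
  next
    fix r assume "r \<in> ev ` B"
    then obtain b where b: "b \<in> B" "r = ev b" by auto
    moreover have "b \<noteq> 0" using orth b by (metis orthonormal_def ip_zero_left zero_neq_one)
    ultimately show "r \<in> eigenvalues_on A V"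
      using BV Ab by (auto simp: eigenvalues_on_def eigenspace_on_def)
  qed
  have "{b\<in>B. ev b \<le> lam} = (\<Union>r\<in>{r \<in> ev ` B. r \<le> lam}. {b\<in>B. ev b = r})" by auto
  then show ?thesis
    unfolding eigenvalue_count_def evs dim using fin
    by (simp, subst card_UN_disjoint) auto
qed

end

section \<open>Comparison with the Dirichlet Laplacian\<close>

lemma subspace_L2: "cfun.subspace (L2 S)"
  by (auto simp: cfun.subspace_def L2_def)

locale symmetric_laplacian =
  fixes X :: "'x pair_pre_digraph"
    and \<mu> :: "'x \<Rightarrow> real"
    and G :: "('g, 'b) monoid_scheme" (structure)
    and \<phi> :: "'g \<Rightarrow> 'x \<Rightarrow> 'x"
    and c :: "'x \<Rightarrow> 'x \<Rightarrow> real"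
    and F :: "'x set"
  assumes pair_graph: "pair_graph X"
    and measure_pos: "x \<in> pverts X \<Longrightarrow> \<mu> x > 0"
    and group: "group G" and finite_G: "finite (carrier G)"
    and action: "group_action G (pverts X) \<phi>"
    and measure_inv: "preserves_measure G (pverts X) \<phi> \<mu>"
    and invariant: "invariant_operator G (pverts X) \<phi> (graph_laplacian X \<mu> c)"
    and self_adjoint: "self_adjoint_on_L2 (pverts X) \<mu> (graph_laplacian X \<mu> c)"
    and fundamental: "fundamental_domain G (pverts X) \<phi> F"
begin

section \<open>The group action and the interior of the fundamental domain\<close>

abbreviation "S \<equiv> pverts X"
abbreviation "A \<equiv> graph_laplacian X \<mu> c"
abbreviation "\<Gamma> \<equiv> carrier G"
abbreviation "bd \<equiv> domain_boundary G X \<phi> F"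
abbreviation "T \<equiv> translation G S \<phi>"

definition "F0 = F - bd"

sublocale group G by (rule group)

sublocale weighted_set S \<mu>
proof
  interpret pair_graph X by (rule pair_graph)
  show "finite S" by (rule pair_finite_verts)
qed (rule measure_pos)

lemma edge_in_S: "(x, y) \<in> parcs X \<Longrightarrow> x \<in> S \<and> y \<in> S"
proof -
  interpret pair_graph X by (rule pair_graph)
  show "(x, y) \<in> parcs X \<Longrightarrow> x \<in> S \<and> y \<in> S" using in_arcsD1 in_arcsD2 by blast
qed

lemma act_closed [simp]: "g \<in> \<Gamma> \<Longrightarrow> x \<in> S \<Longrightarrow> \<phi> g x \<in> S"
  using group_action.element_image[OF action] by blast

lemma act_mult: "g \<in> \<Gamma> \<Longrightarrow> h \<in> \<Gamma> \<Longrightarrow> x \<in> S \<Longrightarrow> \<phi> (g \<otimes> h) x = \<phi> g (\<phi> h x)"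
  using group_action.composition_rule[OF action] by blast

lemma act_one [simp]: "x \<in> S \<Longrightarrow> \<phi> \<one> x = x"
  using group_action.id_eq_one[OF action] by (metis restrict_apply')

lemma act_inv [simp]:
  assumes "g \<in> \<Gamma>" "x \<in> S"
  shows "\<phi> (inv g) (\<phi> g x) = x" and "\<phi> g (\<phi> (inv g) x) = x"
  using assms by (simp_all flip: act_mult)

lemma mu_act [simp]: "g \<in> \<Gamma> \<Longrightarrow> x \<in> S \<Longrightarrow> \<mu> (\<phi> g x) = \<mu> x"
  using measure_inv by (simp add: preserves_measure_def)

lemma F_sub: "F \<subseteq> S" and F_cover: "x \<in> S \<Longrightarrow> \<exists>g\<in>\<Gamma>. \<exists>y\<in>F. x = \<phi> g y"
  using fundamental by (auto simp: fundamental_domain_def)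

lemma bd_sub: "bd \<subseteq> F" by (auto simp: domain_boundary_def)

lemma finite_bd: "finite bd"
  using finite_S F_sub bd_sub by (meson finite_subset)

lemma F0_D: "x \<in> F0 \<Longrightarrow> x \<in> S" "x \<in> F0 \<Longrightarrow> x \<in> F" "x \<in> F0 \<Longrightarrow> x \<notin> bd"
  using F_sub by (auto simp: F0_def)

text \<open>If \<open>g\<close> takes \<open>x\<close> into \<open>F\<close>, then \<open>x\<close>
  lies in the translate of \<open>F\<close> by \<open>inv g\<close>; for \<open>g\<close> other than
  the unit this would make \<open>x\<close> a boundary point. It follows that the translates of
  \<open>F0\<close> are pairwise disjoint and that points of \<open>F0\<close> have trivial
  stabiliser.\<close>

lemma F0_free:
  assumes "x \<in> F0" "g \<in> \<Gamma>" "\<phi> g x \<in> F"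
  shows "g = \<one>"
proof (rule ccontr)
  assume "g \<noteq> \<one>"
  then have "inv g \<noteq> \<one>" using assms by (metis inv_one inv_inv)
  moreover have "x \<in> \<phi> (inv g) ` F" using assms F0_D by (metis act_inv(1) imageI)
  ultimately have "x \<in> bd" unfolding domain_boundary_def using assms F0_D(2) inv_closed by blast
  then show False using assms F0_D by blast
qed

lemma F0_edge:
  assumes "x \<in> F0" "g \<in> \<Gamma>" "y \<in> F" "(x, \<phi> g y) \<in> parcs X"
  shows "g = \<one>"
proof (rule ccontr)
  assume "g \<noteq> \<one>"
  then have "x \<in> bd" using assms F0_D by (auto simp: domain_boundary_def)
  then show False using assms F0_D by blast
qed

lemma translation_apply: "g \<in> \<Gamma> \<Longrightarrow> x \<in> S \<Longrightarrow> T g u x = u (\<phi> (inv g) x)"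
  by (simp add: translation_def pullback_def)

section \<open>The Laplacian and its Dirichlet restriction\<close>

lemma clinear_A: "clinear A"
  by (rule clinearI)
    (auto simp: graph_laplacian_def fun_eq_iff algebra_simps sum.distrib sum_subtractf sum_distrib_left)

lemma A_in_L2: "A u \<in> L2 S"
  by (simp add: graph_laplacian_def L2_def)

lemma A_sym: "u \<in> L2 S \<Longrightarrow> v \<in> L2 S \<Longrightarrow> ip (A u) v = ip u (A v)"
  using self_adjoint by (simp add: self_adjoint_on_L2_def)

text \<open>The Laplacian with Dirichlet condition on the complement of \<open>F0\<close>.\<close>

definition A0 :: "('x \<Rightarrow> complex) \<Rightarrow> 'x \<Rightarrow> complex" where
  "A0 u = (\<lambda>x. if x \<in> F0 then A u x else 0)"

lemma clinear_A0: "clinear A0"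
  by (rule clinearI) (auto simp: A0_def clinear_add[OF clinear_A] clinear_scale[OF clinear_A] fun_eq_iff)

lemma A0_in_L2: "A0 u \<in> L2 F0"
  by (simp add: A0_def L2_def)

lemma L2_F0: "L2 F0 \<subseteq> L2 S"
  using F0_D by (auto simp: L2_def)

lemma ip_A0: "v \<in> L2 F0 \<Longrightarrow> ip (A0 u) v = ip (A u) v"
  unfolding L2_inner_def by (rule sum.cong) (auto simp: A0_def L2_def)

lemma A0_sym:
  assumes "u \<in> L2 F0" "v \<in> L2 F0"
  shows "ip (A0 u) v = ip u (A0 v)"
proof -
  have "ip u (A0 v) = cnj (ip (A v) u)" using assms by (subst ip_cnj) (simp add: ip_A0)
  also have "\<dots> = ip (A u) v" using A_sym[of u v] subsetD[OF L2_F0 assms(1)] subsetD[OF L2_F0 assms(2)]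
    by (simp flip: ip_cnj)
  finally show ?thesis using assms by (simp add: ip_A0)
qed

section \<open>Restricting functions to the translates of the interior\<close>

definition loc :: "('x \<Rightarrow> complex) \<Rightarrow> 'g \<Rightarrow> 'x \<Rightarrow> complex" where
  "loc u g = (\<lambda>x. if x \<in> F0 then u (\<phi> (inv g) x) else 0)"

definition vanishing_on_boundary :: "('x \<Rightarrow> complex) \<Rightarrow> bool" where
  "vanishing_on_boundary u \<longleftrightarrow> (\<forall>g\<in>\<Gamma>. \<forall>x\<in>bd. u (\<phi> (inv g) x) = 0)"

lemma loc_in_L2: "loc u g \<in> L2 F0"
  by (simp add: loc_def L2_def)

text \<open>Here \<open>loc u g\<close> is the part of \<open>u\<close> on the translate of
  \<open>F0\<close> by \<open>inv g\<close>, carried back to \<open>F0\<close>. By invariance,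
  \<open>A u\<close> there can be computed from the pulled back function near a point
  \<open>x\<close> of \<open>F0\<close>. All neighbours of \<open>x\<close> lie in \<open>F\<close>;
  those outside \<open>F0\<close> are boundary points, where the pulled back function vanishes.
  Hence it agrees with \<open>loc u g\<close> at every point that enters the Laplacian at
  \<open>x\<close>.\<close>

lemma loc_A:
  assumes u: "u \<in> L2 S" "vanishing_on_boundary u" and g: "g \<in> \<Gamma>"
  shows "loc (A u) g = A0 (loc u g)"
proof -
  have "A u (\<phi> (inv g) x) = A (loc u g) x" if x: "x \<in> F0" for x
  proof -
    have xS: "x \<in> S" using x F0_D by blast
    have "A u (\<phi> (inv g) x) = pullback S \<phi> (inv g) (A u) x"
      using xS by (simp add: pullback_def)
    also have "\<dots> = A (pullback S \<phi> (inv g) u) x"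
      using invariant u g by (simp add: invariant_operator_def)
    also have "\<dots> = A (loc u g) x"
    proof -
      have "pullback S \<phi> (inv g) u y = loc u g y" if y: "(x, y) \<in> parcs X" for y
      proof (cases "y \<in> F0")
        case True then show ?thesis using F0_D by (simp add: pullback_def loc_def)
      next
        case False
        have yS: "y \<in> S" using y edge_in_S by blast
        then obtain h z where h: "h \<in> \<Gamma>" "z \<in> F" "y = \<phi> h z" using F_cover by blast
        then have "h = \<one>" using F0_edge x y by blast
        then have "y = z" using h F_sub by auto
        then have "y \<in> bd" using h False by (auto simp: F0_def)
        then show ?thesis using u g yS False
          by (simp add: pullback_def loc_def vanishing_on_boundary_def)
      qed
      moreover have "pullback S \<phi> (inv g) u x = loc u g x"
        using x xS by (simp add: pullback_def loc_def)
      ultimately show ?thesis using xS by (auto simp: graph_laplacian_def intro!: sum.cong)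
    qed
    finally show ?thesis .
  qed
  then show ?thesis by (auto simp: loc_def A0_def fun_eq_iff)
qed

text \<open>The translates of \<open>F0\<close> are disjoint by \<open>F0_free\<close>, and any
  point of \<open>S\<close> outside them is a translate of a boundary point, where \<open>f\<close>
  vanishes.\<close>

lemma sum_over_translates:
  fixes f :: "'x \<Rightarrow> complex"
  assumes "\<And>g x. g \<in> \<Gamma> \<Longrightarrow> x \<in> bd \<Longrightarrow> f (\<phi> (inv g) x) = 0"
  shows "(\<Sum>y\<in>S. f y) = (\<Sum>g\<in>\<Gamma>. \<Sum>x\<in>F0. f (\<phi> (inv g) x))"
proof -
  let ?p = "\<lambda>(g, x). \<phi> (inv g) x"
  have inj: "inj_on ?p (\<Gamma> \<times> F0)"
  proof (rule inj_onI, clarify)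
    fix g x h y assume a: "g \<in> \<Gamma>" "x \<in> F0" "h \<in> \<Gamma>" "y \<in> F0" "\<phi> (inv g) x = \<phi> (inv h) y"
    have S: "x \<in> S" "y \<in> S" using a F0_D by auto
    have "\<phi> (h \<otimes> inv g) x = y" using a S by (simp add: act_mult)
    then have "h \<otimes> inv g = \<one>" using F0_free[of x "h \<otimes> inv g"] a F0_D by auto
    then have "h = g" using a by (metis inv_closed inv_equality inv_inv)
    moreover have "x = y" using a S \<open>h = g\<close> by (metis act_inv(2))
    ultimately show "g = h \<and> x = y" by simp
  qed
  have "f y = 0" if "y \<in> S - ?p ` (\<Gamma> \<times> F0)" for y
  proof -
    from that have "y \<in> S" by simp
    then obtain g z where g: "g \<in> \<Gamma>" "z \<in> F" "y = \<phi> g z" by (blast dest: F_cover)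
    \<comment> \<open>The hypothesis speaks of translates by inverses, so \<open>g\<close> is
      written as the inverse of \<open>inv g\<close>.\<close>
    then have y: "y = \<phi> (inv (inv g)) z" by simp
    have "z \<notin> F0"
    proof
      assume "z \<in> F0"
      then have "y \<in> ?p ` (\<Gamma> \<times> F0)" using g by (intro image_eqI[of _ _ "(inv g, z)"]) simp_all
      with that show False by blast
    qed
    then have "z \<in> bd" using g by (simp add: F0_def)
    then show ?thesis unfolding y using assms g by blast
  qed
  then have "(\<Sum>y\<in>S. f y) = (\<Sum>y\<in>?p ` (\<Gamma> \<times> F0). f y)"
    by (intro sum.mono_neutral_right finite_S) (auto simp: F0_D)
  also have "\<dots> = (\<Sum>(g, x)\<in>\<Gamma> \<times> F0. f (\<phi> (inv g) x))"
    by (subst sum.reindex[OF inj]) (auto intro!: sum.cong)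
  finally show ?thesis by (simp add: sum.cartesian_product)
qed

lemma ip_loc:
  assumes "vanishing_on_boundary u"
  shows "ip w u = (\<Sum>g\<in>\<Gamma>. ip (loc w g) (loc u g))"
proof -
  have "ip w u = (\<Sum>g\<in>\<Gamma>. \<Sum>x\<in>F0. w (\<phi> (inv g) x) * cnj (u (\<phi> (inv g) x)) * of_real (\<mu> (\<phi> (inv g) x)))"
    unfolding L2_inner_def
    by (rule sum_over_translates) (use assms in \<open>auto simp: vanishing_on_boundary_def\<close>)
  also have "\<dots> = (\<Sum>g\<in>\<Gamma>. ip (loc w g) (loc u g))"
    unfolding L2_inner_def
    by (intro sum.cong refl sum.mono_neutral_cong_left finite_S) (auto simp: loc_def F0_D)
  finally show ?thesis .
qed

lemma form_loc:
  assumes "u \<in> L2 S" "vanishing_on_boundary u"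
  shows "ip (A u) u = (\<Sum>g\<in>\<Gamma>. ip (A0 (loc u g)) (loc u g))"
  unfolding ip_loc[OF assms(2)] by (rule sum.cong) (auto simp: loc_A[OF assms])

lemma eq_zero_if_loc_zero:
  assumes "u \<in> L2 S" "vanishing_on_boundary u" "\<And>g. g \<in> \<Gamma> \<Longrightarrow> loc u g = 0"
  shows "u = 0"
proof -
  have "ip u u = 0" unfolding ip_loc[OF assms(2)] using assms(3) by simp
  then show ?thesis using ip_self_eq_0_iff assms by blast
qed

lemma form_le_if_loc:
  assumes "u \<in> L2 S" "vanishing_on_boundary u"
    and "\<And>g. g \<in> \<Gamma> \<Longrightarrow> Re (ip (A0 (loc u g)) (loc u g)) \<le> lam * Re (ip (loc u g) (loc u g))"
  shows "Re (ip (A u) u) \<le> lam * Re (ip u u)"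
  unfolding form_loc[OF assms(1,2)] ip_loc[OF assms(2), of u] Re_sum sum_distrib_left
  using assms(3) by (intro sum_mono) auto

text \<open>Pieces that are zero give equality, so strictness needs one nonzero piece; it exists
  because \<open>u\<close> is determined by its pieces.\<close>

lemma form_gt_if_loc:
  assumes "u \<in> L2 S" "vanishing_on_boundary u" "u \<noteq> 0"
    and "\<And>g. g \<in> \<Gamma> \<Longrightarrow> loc u g \<noteq> 0 \<Longrightarrow>
      lam * Re (ip (loc u g) (loc u g)) < Re (ip (A0 (loc u g)) (loc u g))"
  shows "lam * Re (ip u u) < Re (ip (A u) u)"
  unfolding form_loc[OF assms(1,2)] ip_loc[OF assms(2), of u] Re_sum sum_distrib_left
proof (rule sum_strict_mono_ex1[OF finite_G])
  have "lam * Re (ip (loc u g) (loc u g)) \<le> Re (ip (A0 (loc u g)) (loc u g))" if "g \<in> \<Gamma>" for g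
    using assms(4)[OF that] by (cases "loc u g = 0") (auto simp: less_imp_le simp del: zero_fun_def)
  then show "\<forall>g\<in>\<Gamma>. lam * Re (ip (loc u g) (loc u g)) \<le> Re (ip (A0 (loc u g)) (loc u g))" by blast
  show "\<exists>g\<in>\<Gamma>. lam * Re (ip (loc u g) (loc u g)) < Re (ip (A0 (loc u g)) (loc u g))"
    using eq_zero_if_loc_zero[OF assms(1,2)] assms(3,4) by blast
qed

text \<open>For \<open>w\<close> supported in \<open>F0\<close> this is the tensor product of
  \<open>m\<close> and \<open>w\<close>: a copy of \<open>w\<close> is placed on every translate of
  \<open>F0\<close>, weighted on the translate by \<open>inv h\<close> with
  \<open>m h\<close>.\<close>

definition induced :: "('g \<Rightarrow> complex) \<Rightarrow> ('x \<Rightarrow> complex) \<Rightarrow> 'x \<Rightarrow> complex" where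
  "induced m w = (\<Sum>g\<in>\<Gamma>. cscale (m g) (pullback S \<phi> g w))"

lemma induced_apply:
  assumes "w \<in> L2 F0" "x \<in> F" "h \<in> \<Gamma>"
  shows "induced m w (\<phi> (inv h) x) = m h * w x"
proof -
  have xS: "x \<in> S" using assms F_sub by auto
  \<comment> \<open>Only the summand \<open>g = h\<close> survives: in any other, a nonzero value
    would give a point of \<open>F0\<close> that \<open>h \<otimes> inv g\<close> moves to
    \<open>x\<close> in \<open>F\<close>, against \<open>F0_free\<close>.\<close>
  have "w (\<phi> g (\<phi> (inv h) x)) = 0" if g: "g \<in> \<Gamma>" "g \<noteq> h" for g
  proof (rule ccontr)
    assume "w (\<phi> g (\<phi> (inv h) x)) \<noteq> 0"
    then have "\<phi> g (\<phi> (inv h) x) \<in> F0" using assms by (auto simp: L2_def)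
    moreover have "\<phi> (h \<otimes> inv g) (\<phi> g (\<phi> (inv h) x)) = x" using g assms xS by (simp add: act_mult)
    ultimately have "h \<otimes> inv g = \<one>" using F0_free assms g by (metis inv_closed m_closed)
    then show False using g assms by (metis inv_closed inv_equality inv_inv)
  qed
  then have "(\<Sum>g\<in>\<Gamma>. m g * w (\<phi> g (\<phi> (inv h) x))) = (\<Sum>g\<in>\<Gamma>. if g = h then m h * w x else 0)"
    using assms xS by (intro sum.cong) auto
  then show ?thesis using assms xS finite_G by (simp add: induced_def sum_fun_apply pullback_def)
qed

lemma dirichlet_eigenbasis: "\<exists>B ev. eigenbasis A0 (L2 F0) B ev"
  using A0_sym A0_in_L2 by (intro eigenbasis_exists subspace_L2 L2_F0 clinear_A0) auto

abbreviation "dirichlet_count lam \<equiv> eigenvalue_count A0 (L2 F0) lam"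

end

text \<open>
  The functions \<open>C s\<close> span the space of functions on the group that occur as
  \<open>g \<mapsto> u (g\<inverse> x)\<close> for \<open>u \<in> V\<close>; \<open>C' s\<close> is a dual family.
\<close>

locale coefficient_system = symmetric_laplacian X \<mu> G \<phi> c F
  for X :: "'x pair_pre_digraph" and \<mu> and G :: "('g, 'b) monoid_scheme" (structure)
    and \<phi> c F +
  fixes V :: "('x \<Rightarrow> complex) set" and Q :: "'q set" and C C' :: "'q \<Rightarrow> 'g \<Rightarrow> complex"
  assumes subspace_V: "cfun.subspace V" and V_sub: "V \<subseteq> L2 S" and A_V: "A ` V \<subseteq> V"
    and finite_Q: "finite Q"
    and dual: "s \<in> Q \<Longrightarrow> t \<in> Q \<Longrightarrow> (\<Sum>g\<in>\<Gamma>. C' s g * C t g) = (if s = t then 1 else 0)"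
    and reproducing: "u \<in> V \<Longrightarrow> x \<in> S \<Longrightarrow> g \<in> \<Gamma> \<Longrightarrow>
        u (\<phi> (inv g) x) = (\<Sum>s\<in>Q. C s g * (\<Sum>h\<in>\<Gamma>. C' s h * u (\<phi> (inv h) x)))"
    and induced_mem: "s \<in> Q \<Longrightarrow> w \<in> L2 S \<Longrightarrow> induced (C s) w \<in> V"
begin

section \<open>Eigenvalue estimates from a coefficient system\<close>

lemma A_sym_V: "u \<in> V \<Longrightarrow> v \<in> V \<Longrightarrow> ip (A u) v = ip u (A v)"
  using A_sym V_sub by blast

lemma eigenbasis_V: "\<exists>B ev. eigenbasis A V B ev"
  using A_sym_V by (intro eigenbasis_exists subspace_V V_sub A_V clinear_A)

text \<open>By \<open>reproducing\<close>, the function sending \<open>g\<close> to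
  \<open>ip (T g u) w\<close> is a combination of the \<open>C s\<close>, and the sums assumed to
  vanish are its coefficients. Thus \<open>card Q\<close> linear conditions annihilate all
  translates at once.\<close>

lemma vanish_if_coefficients_vanish:
  assumes u: "u \<in> V" and zero: "\<And>s. s \<in> Q \<Longrightarrow> (\<Sum>h\<in>\<Gamma>. C' s h * ip (T h u) w) = 0"
    and g: "g \<in> \<Gamma>"
  shows "ip (T g u) w = 0"
proof -
  have "ip (T g u) w = (\<Sum>x\<in>S. (\<Sum>s\<in>Q. C s g * (\<Sum>h\<in>\<Gamma>. C' s h * T h u x)) * cnj (w x) * of_real (\<mu> x))"
    unfolding L2_inner_def
    by (intro sum.cong refl) (simp add: translation_apply g reproducing[OF u _ g, symmetric] cong: sum.cong)
  also have "\<dots> = (\<Sum>s\<in>Q. \<Sum>x\<in>S. C s g * ((\<Sum>h\<in>\<Gamma>. C' s h * T h u x) * (cnj (w x) * of_real (\<mu> x))))"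
    unfolding sum_distrib_right mult.assoc by (rule sum.swap)
  also have "\<dots> = (\<Sum>s\<in>Q. C s g * (\<Sum>h\<in>\<Gamma>. C' s h * ip (T h u) w))"
  proof (rule sum.cong[OF refl])
    fix s
    have "(\<Sum>x\<in>S. (\<Sum>h\<in>\<Gamma>. C' s h * T h u x) * (cnj (w x) * of_real (\<mu> x))) =
        (\<Sum>h\<in>\<Gamma>. C' s h * ip (T h u) w)"
      unfolding L2_inner_def sum_distrib_left sum_distrib_right mult.assoc by (rule sum.swap)
    then show "(\<Sum>x\<in>S. C s g * ((\<Sum>h\<in>\<Gamma>. C' s h * T h u x) * (cnj (w x) * of_real (\<mu> x)))) =
        C s g * (\<Sum>h\<in>\<Gamma>. C' s h * ip (T h u) w)"
      unfolding sum_distrib_left[symmetric] by simp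
  qed
  finally show ?thesis using zero by simp
qed

lemma loc_ip: "g \<in> \<Gamma> \<Longrightarrow> w \<in> L2 F0 \<Longrightarrow> ip (loc u g) w = ip (T g u) w"
  unfolding L2_inner_def by (intro sum.cong) (auto simp: loc_def L2_def translation_apply)

text \<open>If the bound failed, some nonzero combination \<open>u\<close> of eigenvectors in
  \<open>V\<close> up to \<open>lam\<close> would satisfy all the conditions indexed by
  \<open>I\<close>. Then \<open>u\<close> vanishes on the translates of the boundary and its pieces
  are orthogonal to the low Dirichlet eigenvectors, so its form exceeds \<open>lam\<close> times its
  squared norm, while the choice of \<open>u\<close> gives the opposite inequality.\<close>

theorem eigenvalue_count_le:
  "eigenvalue_count A V lam \<le> card Q * (dirichlet_count lam + card bd)"
proof (rule ccontr)
  assume neg: "\<not> ?thesis"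
  obtain B ev where eb: "eigenbasis A V B ev" using eigenbasis_V by blast
  obtain B0 ev0 where eb0: "eigenbasis A0 (L2 F0) B0 ev0" using dirichlet_eigenbasis by blast
  have cnt: "eigenvalue_count A V lam = card {b\<in>B. ev b \<le> lam}"
    using eigenbasis_count[OF eb subspace_V clinear_A] A_sym_V by blast
  have cnt0: "dirichlet_count lam = card {b\<in>B0. ev0 b \<le> lam}"
    using eigenbasis_count[OF eb0 subspace_L2 clinear_A0] A0_sym by blast
  have fin: "finite B" "finite B0" and BV: "B \<subseteq> V" and B0: "B0 \<subseteq> L2 F0"
    and orth: "orthonormal B"
    using eb eb0 by (auto simp: eigenbasis_def)
  define K where "K = {b\<in>B. ev b \<le> lam}"
  define W where "W = {b\<in>B0. ev0 b \<le> lam}"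
  \<comment> \<open>For each \<open>s\<close> there is one condition per boundary point
    (\<open>Inl\<close>) and one per low Dirichlet eigenvector (\<open>Inr\<close>).\<close>
  define I where "I = Q \<times> (bd <+> W)"
  define M where "M = (\<lambda>(s, i) b. case i of
      Inl x \<Rightarrow> (\<Sum>h\<in>\<Gamma>. C' s h * b (\<phi> (inv h) x))
    | Inr w \<Rightarrow> (\<Sum>h\<in>\<Gamma>. C' s h * ip (T h b) w))"
  have "finite I" "finite K" using fin finite_Q finite_bd by (auto simp: I_def K_def W_def)
  moreover have "card I < card K"
    using neg fin finite_Q finite_bd
    by (simp add: I_def card_cartesian_product card_Plus cnt cnt0 W_def K_def add.commute)
  ultimately obtain a where a: "\<exists>b\<in>K. a b \<noteq> 0" "\<forall>i\<in>I. (\<Sum>b\<in>K. M i b * a b) = 0"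
    using homogeneous_system_nontrivial by blast
  \<comment> \<open>Extension by zero to all of \<open>B\<close> allows the components of
    \<open>u\<close> to be read off from the full eigenbasis.\<close>
  define a' where "a' b = (if b \<in> K then a b else 0)" for b
  define u where "u = (\<Sum>b\<in>B. cscale (a' b) b)"
  have u: "u \<in> V"
    unfolding u_def using BV by (intro cfun.subspace_sum cfun.subspace_scale subspace_V) auto
  have ipu: "ip u b = a' b" if "b \<in> B" for b
    unfolding u_def using ip_orthonormal_expansion[OF orth fin(1) that] .
  have uK: "u = (\<Sum>b\<in>K. cscale (a b) b)"
    unfolding u_def a'_def K_def using fin
    by (intro sum.mono_neutral_cong_right) (auto simp: fun_eq_iff)
  have "u \<noteq> 0" using a(1) ipu by (metis (no_types, lifting) K_def a'_def ip_zero_left mem_Collect_eq)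
  have u_at: "(\<Sum>h\<in>\<Gamma>. C' s h * u (\<phi> (inv h) x)) = 0" if "s \<in> Q" "x \<in> bd" for s x
  proof -
    have "(\<Sum>h\<in>\<Gamma>. C' s h * u (\<phi> (inv h) x)) = (\<Sum>b\<in>K. M (s, Inl x) b * a b)"
      unfolding uK M_def
      by (simp add: sum_fun_apply sum_distrib_left sum_distrib_right mult_ac) (rule sum.swap)
    then show ?thesis using a(2) that by (auto simp: I_def)
  qed
  have u_ip: "(\<Sum>h\<in>\<Gamma>. C' s h * ip (T h u) w) = 0" if "s \<in> Q" "w \<in> W" for s w
  proof -
    have "T h u = (\<Sum>b\<in>K. cscale (a b) (T h b))" for h
      by (auto simp: uK translation_def pullback_def sum_fun_apply fun_eq_iff)
    then have "(\<Sum>h\<in>\<Gamma>. C' s h * ip (T h u) w) = (\<Sum>b\<in>K. M (s, Inr w) b * a b)"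
      unfolding M_def
      by (simp add: ip_sum_left ip_scale_left sum_distrib_left sum_distrib_right mult_ac) (rule sum.swap)
    then show ?thesis using a(2) that by (auto simp: I_def)
  qed
  have uL2: "u \<in> L2 S" using u V_sub by blast
  have van: "vanishing_on_boundary u"
    unfolding vanishing_on_boundary_def
  proof (intro ballI)
    fix g x assume "g \<in> \<Gamma>" "x \<in> bd"
    then show "u (\<phi> (inv g) x) = 0"
      using reproducing[OF u, of x g] u_at bd_sub F_sub by (auto simp: subset_iff)
  qed
  have "lam * Re (ip u u) < Re (ip (A u) u)"
  proof (rule form_gt_if_loc[OF uL2 van \<open>u \<noteq> 0\<close>])
    fix g assume g: "g \<in> \<Gamma>" "loc u g \<noteq> 0"
    show "lam * Re (ip (loc u g) (loc u g)) < Re (ip (A0 (loc u g)) (loc u g))"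
    proof (rule eigenbasis_form_gt[OF eb0 loc_in_L2 clinear_A0 _ g(2)])
      fix w assume "w \<in> B0" "ev0 w \<le> lam"
      then have "w \<in> W" "w \<in> L2 F0" using B0 by (auto simp: W_def)
      then show "ip (loc u g) w = 0"
        using vanish_if_coefficients_vanish[OF u u_ip g(1)] g(1) loc_ip by simp
    qed
  qed
  moreover have "Re (ip (A u) u) \<le> lam * Re (ip u u)"
    by (rule eigenbasis_form_le[OF eb u clinear_A]) (auto simp: ipu a'_def K_def)
  ultimately show False by simp
qed

text \<open>If the bound failed, some nontrivial combination \<open>u\<close> of the functions
  \<open>induced (C s) w\<close>, with \<open>w\<close> a low Dirichlet eigenvector, would be
  orthogonal to every eigenvector in \<open>V\<close> up to \<open>lam\<close>, so its form would
  exceed \<open>lam\<close> times its squared norm. Yet every piece of \<open>u\<close> lies in the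
  span of the low Dirichlet eigenvectors, which gives the opposite inequality.\<close>

theorem eigenvalue_count_ge:
  "card Q * dirichlet_count lam \<le> eigenvalue_count A V lam"
proof (rule ccontr)
  assume neg: "\<not> ?thesis"
  obtain B ev where eb: "eigenbasis A V B ev" using eigenbasis_V by blast
  obtain B0 ev0 where eb0: "eigenbasis A0 (L2 F0) B0 ev0" using dirichlet_eigenbasis by blast
  have cnt: "eigenvalue_count A V lam = card {b\<in>B. ev b \<le> lam}"
    using eigenbasis_count[OF eb subspace_V clinear_A] A_sym_V by blast
  have cnt0: "dirichlet_count lam = card {b\<in>B0. ev0 b \<le> lam}"
    using eigenbasis_count[OF eb0 subspace_L2 clinear_A0] A0_sym by blast
  have fin: "finite B" "finite B0" and B0: "B0 \<subseteq> L2 F0" and orth0: "orthonormal B0"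
    using eb eb0 by (auto simp: eigenbasis_def)
  define I where "I = {b\<in>B. ev b \<le> lam}"
  define W where "W = {b\<in>B0. ev0 b \<le> lam}"
  have W: "finite W" "orthonormal W" "W \<subseteq> L2 F0"
    using fin B0 orth0 by (auto simp: W_def orthonormal_def)
  obtain a where a: "\<exists>k\<in>Q \<times> W. a k \<noteq> 0"
    "\<forall>b\<in>I. (\<Sum>k\<in>Q \<times> W. (case k of (s, w) \<Rightarrow> ip (induced (C s) w) b) * a k) = 0"
  proof -
    have "finite I" "finite (Q \<times> W)" "card I < card (Q \<times> W)"
      using neg fin finite_Q by (auto simp: cnt cnt0 I_def W_def card_cartesian_product)
    from homogeneous_system_nontrivial[OF this, of "\<lambda>b k. case k of (s, w) \<Rightarrow> ip (induced (C s) w) b"]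
    show ?thesis by (elim exE conjE) (rule that)
  qed
  define u where "u = (\<Sum>(s, w)\<in>Q \<times> W. cscale (a (s, w)) (induced (C s) w))"
  have u: "u \<in> V"
    unfolding u_def
  proof (intro cfun.subspace_sum subspace_V, clarify)
    fix s w assume "s \<in> Q" "w \<in> W"
    with W(3) L2_F0 have "induced (C s) w \<in> V" by (blast intro: induced_mem)
    then show "cscale (a (s, w)) (induced (C s) w) \<in> V" by (rule cfun.subspace_scale[OF subspace_V])
  qed
  have ipu: "ip u b = 0" if "b \<in> B" "ev b \<le> lam" for b
  proof -
    have "ip u b = (\<Sum>k\<in>Q \<times> W. (case k of (s, w) \<Rightarrow> ip (induced (C s) w) b) * a k)"
      unfolding u_def ip_sum_left by (intro sum.cong) (auto simp: ip_scale_left)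
    then show ?thesis using a(2) that by (simp add: I_def)
  qed
  have u_at: "u (\<phi> (inv h) x) = (\<Sum>(s, w)\<in>Q \<times> W. a (s, w) * C s h * w x)"
    if "h \<in> \<Gamma>" "x \<in> F" for h x
    unfolding u_def sum_fun_apply
  proof (intro sum.cong refl, clarify)
    fix s w assume "s \<in> Q" "w \<in> W"
    then have "w \<in> L2 F0" using W(3) by blast
    then show "cscale (a (s, w)) (induced (C s) w) (\<phi> (inv h) x) = a (s, w) * C s h * w x"
      using that by (simp add: induced_apply)
  qed
  have loc_u: "loc u h = (\<Sum>w\<in>W. cscale (\<Sum>s\<in>Q. a (s, w) * C s h) w)" if "h \<in> \<Gamma>" for h
  proof
    fix x
    show "loc u h x = (\<Sum>w\<in>W. cscale (\<Sum>s\<in>Q. a (s, w) * C s h) w) x"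
    proof (cases "x \<in> F0")
      case True
      then have "loc u h x = (\<Sum>s\<in>Q. \<Sum>w\<in>W. a (s, w) * C s h * w x)"
        using u_at[OF that] F0_D by (simp add: loc_def sum.cartesian_product)
      also have "\<dots> = (\<Sum>w\<in>W. cscale (\<Sum>s\<in>Q. a (s, w) * C s h) w) x"
        unfolding sum_fun_apply cscale_apply sum_distrib_right by (rule sum.swap)
      finally show ?thesis .
    next
      case False
      then have "w x = 0" if "w \<in> W" for w using W(3) that by (auto simp: L2_def)
      then show ?thesis using False by (simp add: loc_def sum_fun_apply)
    qed
  qed
  \<comment> \<open>The induced functions are linearly independent: orthonormality of
    \<open>W\<close> separates the indices \<open>w\<close>, and the dual family \<open>C'\<close>
    then separates the indices \<open>s\<close>.\<close>
  have "u \<noteq> 0"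
  proof
    assume "u = 0"
    have "(\<Sum>s\<in>Q. a (s, w) * C s h) = 0" if "w \<in> W" "h \<in> \<Gamma>" for w h
    proof -
      have "loc u h = 0" using \<open>u = 0\<close> by (auto simp: loc_def)
      then show ?thesis
        using ip_orthonormal_expansion[OF W(2,1) that(1), of "\<lambda>w. \<Sum>s\<in>Q. a (s, w) * C s h"] loc_u[OF that(2)]
        by (simp del: zero_fun_def)
    qed note zero = this
    have "a (t, w) = 0" if t: "t \<in> Q" "w \<in> W" for t w
    proof -
      have "0 = (\<Sum>h\<in>\<Gamma>. C' t h * (\<Sum>s\<in>Q. a (s, w) * C s h))" using zero t by simp
      also have "\<dots> = (\<Sum>s\<in>Q. a (s, w) * (\<Sum>h\<in>\<Gamma>. C' t h * C s h))"
        unfolding sum_distrib_left by (subst sum.swap) (simp add: mult_ac)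
      also have "\<dots> = (\<Sum>s\<in>Q. if t = s then a (s, w) else 0)"
        using t by (intro sum.cong) (auto simp: dual)
      also have "\<dots> = a (t, w)" using t finite_Q by simp
      finally show ?thesis by simp
    qed
    then show False using a(1) by auto
  qed
  have uL2: "u \<in> L2 S" using u V_sub by blast
  have van: "vanishing_on_boundary u"
    unfolding vanishing_on_boundary_def
  proof (intro ballI)
    fix g x assume gx: "g \<in> \<Gamma>" "x \<in> bd"
    have "w x = 0" if "w \<in> W" for w using W(3) that gx(2) F0_D(3) unfolding L2_def by blast
    then show "u (\<phi> (inv g) x) = 0"
      using u_at[of g x] gx bd_sub by (subst u_at) (auto intro!: sum.neutral)
  qed
  have "Re (ip (A u) u) \<le> lam * Re (ip u u)"
  proof (rule form_le_if_loc[OF uL2 van])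
    fix g assume g: "g \<in> \<Gamma>"
    show "Re (ip (A0 (loc u g)) (loc u g)) \<le> lam * Re (ip (loc u g) (loc u g))"
    proof (rule eigenbasis_form_le[OF eb0 loc_in_L2 clinear_A0])
      fix w' assume w': "w' \<in> B0" "lam < ev0 w'"
      have "ip w w' = 0" if "w \<in> W" for w using that w' orth0 by (auto simp: W_def orthonormal_def)
      then show "ip (loc u g) w' = 0"
        by (simp add: loc_u[OF g] ip_sum_left ip_scale_left)
    qed
  qed
  moreover have "lam * Re (ip u u) < Re (ip (A u) u)"
    by (rule eigenbasis_form_gt[OF eb u clinear_A ipu \<open>u \<noteq> 0\<close>])
  ultimately show False by simp
qed

end

section \<open>Orthogonality of matrix coefficients\<close>

locale unitary_irrep = group G
  for G :: "('g, 'b) monoid_scheme" (structure) +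
  fixes n :: nat and \<rho> :: "'g \<Rightarrow> complex mat"
  assumes finite_carrier: "finite (carrier G)"
    and rep: "unitary_rep G n \<rho>" and irreducible: "irreducible_rep G n \<rho>"
begin

lemma n_pos: "n > 0"
  using irreducible by (simp add: irreducible_rep_def)

lemma rep_carrier: "g \<in> carrier G \<Longrightarrow> \<rho> g \<in> carrier_mat n n"
  using rep by (auto simp: unitary_rep_def hom_def unitary_group_def)

lemma rep_dim [simp]: "g \<in> carrier G \<Longrightarrow> dim_row (\<rho> g) = n" "g \<in> carrier G \<Longrightarrow> dim_col (\<rho> g) = n"
  using rep_carrier by auto

lemma rep_mult: "g \<in> carrier G \<Longrightarrow> h \<in> carrier G \<Longrightarrow> \<rho> (g \<otimes> h) = \<rho> g * \<rho> h"
  using rep by (auto simp: unitary_rep_def hom_def unitary_group_def)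

text \<open>Membership in \<open>hom\<close> only gives multiplicativity, so the unit is recovered
  from the fact that an idempotent unitary matrix is the identity.\<close>

lemma rep_one: "\<rho> \<one> = 1\<^sub>m n"
proof -
  let ?U = "\<rho> \<one>"
  have U: "?U \<in> carrier_mat n n" "mat_adjoint ?U * ?U = 1\<^sub>m n"
    using rep by (auto simp: unitary_rep_def hom_def unitary_group_def)
  have adj: "mat_adjoint ?U \<in> carrier_mat n n" using U(1) by (simp add: mat_adjoint_def mat_of_rows_def)
  have "?U * ?U = ?U" using rep_mult[of \<one> \<one>] by simp
  then have "mat_adjoint ?U * (?U * ?U) = 1\<^sub>m n" using U(2) by simp
  then show ?thesis using assoc_mult_mat[OF adj U(1) U(1)] U by simp
qed

lemma rep_mult_index:
  assumes "g \<in> carrier G" "h \<in> carrier G" "a < n" "b < n"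
  shows "\<rho> (g \<otimes> h) $$ (a, b) = (\<Sum>e<n. \<rho> g $$ (a, e) * \<rho> h $$ (e, b))"
  using assms by (simp add: rep_mult scalar_prod_def lessThan_atLeast0)

lemma rep_mult_vec_index:
  assumes "g \<in> carrier G" "a < n" "v \<in> carrier_vec n"
  shows "(\<rho> g *\<^sub>v v) $ a = (\<Sum>b<n. \<rho> g $$ (a, b) * v $ b)"
  using assms by (simp add: scalar_prod_def lessThan_atLeast0)

lemma irreducible_cases:
  assumes "W \<subseteq> carrier_vec n" "0\<^sub>v n \<in> W"
    and "\<And>v w. v \<in> W \<Longrightarrow> w \<in> W \<Longrightarrow> v + w \<in> W" "\<And>a v. v \<in> W \<Longrightarrow> a \<cdot>\<^sub>v v \<in> W"
    and "\<And>g v. g \<in> carrier G \<Longrightarrow> v \<in> W \<Longrightarrow> \<rho> g *\<^sub>v v \<in> W"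
  shows "W = {0\<^sub>v n} \<or> W = carrier_vec n"
proof -
  have "submodule class_ring W (module_vec TYPE(complex) n)"
    using assms by (intro submodule.intro vec_module) (auto simp: module_vec_simps)
  then have "VectorSpace.subspace class_ring W (module_vec TYPE(complex) n)"
    by (simp add: VectorSpace.subspace_def vec_vs)
  then show ?thesis using irreducible assms(5) unfolding irreducible_rep_def by blast
qed

text \<open>An eigenspace of \<open>M\<close> is invariant because \<open>M\<close> commutes with
  the representation, and it is nonzero, so by irreducibility it is the whole space.\<close>

lemma schur:
  assumes M: "M \<in> carrier_mat n n" and comm: "\<And>g. g \<in> carrier G \<Longrightarrow> \<rho> g * M = M * \<rho> g"
  shows "\<exists>z. M = z \<cdot>\<^sub>m 1\<^sub>m n"
proof -
  have "\<not> constant (poly (char_poly M))"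
    using degree_monic_char_poly[OF M] n_pos by (simp add: constant_degree)
  then obtain z where "poly (char_poly M) z = 0" using fundamental_theorem_of_algebra by blast
  then obtain v where v: "v \<in> carrier_vec n" "v \<noteq> 0\<^sub>v n" "M *\<^sub>v v = z \<cdot>\<^sub>v v"
    using M by (auto simp: eigenvalue_root_char_poly[OF M, symmetric] eigenvalue_def eigenvector_def)
  define W where "W = {v \<in> carrier_vec n. M *\<^sub>v v = z \<cdot>\<^sub>v v}"
  have "W = {0\<^sub>v n} \<or> W = carrier_vec n"
  proof (rule irreducible_cases)
    fix g w assume g: "g \<in> carrier G" and w: "w \<in> W"
    then have wc: "w \<in> carrier_vec n" and Mw: "M *\<^sub>v w = z \<cdot>\<^sub>v w" by (auto simp: W_def)
    have \<rho>: "\<rho> g \<in> carrier_mat n n" using rep_carrier g .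
    have "M *\<^sub>v (\<rho> g *\<^sub>v w) = (M * \<rho> g) *\<^sub>v w"
      using assoc_mult_mat_vec[OF M \<rho> wc] by simp
    also have "\<dots> = \<rho> g *\<^sub>v (M *\<^sub>v w)"
      using assoc_mult_mat_vec[OF \<rho> M wc] comm[OF g] by simp
    also have "\<dots> = z \<cdot>\<^sub>v (\<rho> g *\<^sub>v w)" unfolding Mw using mult_mat_vec[OF \<rho> wc] .
    finally show "\<rho> g *\<^sub>v w \<in> W" using \<rho> wc by (simp add: W_def)
  qed (use M in \<open>auto simp: W_def mult_add_distrib_mat_vec mult_mat_vec smult_add_distrib_vec smult_smult_assoc mult.commute\<close>)
  with v have W: "W = carrier_vec n" by (auto simp: W_def)
  have "M $$ (a, b) = (z \<cdot>\<^sub>m 1\<^sub>m n) $$ (a, b)" if "a < n" "b < n" for a b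
  proof -
    have "unit_vec n b \<in> W" unfolding W by simp
    then have "(M *\<^sub>v unit_vec n b) $ a = (z \<cdot>\<^sub>v unit_vec n b) $ a" by (simp add: W_def)
    then show ?thesis using that M by (auto split: if_splits)
  qed
  then show ?thesis using M by (intro exI[of _ z] eq_matI) auto
qed

text \<open>For fixed \<open>b\<close> and \<open>c\<close> the sums form a matrix in
  \<open>a\<close> and \<open>d\<close>, the average (up to scaling) of \<rho>(g) E \<rho>(g)^-1
  with E the matrix unit at (b, c). It commutes with the representation, so Schur's lemma makes it
  scalar, and its trace determines the scalar.\<close>

theorem schur_orthogonality:
  assumes a: "a < n" and b: "b < n" and c: "c < n" and d: "d < n"
  shows "(\<Sum>g\<in>carrier G. \<rho> g $$ (a, b) * \<rho> (inv g) $$ (c, d)) =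
    (if a = d \<and> b = c then of_nat (Coset.order G) / of_nat n else 0)"
proof -
  define m where "m a d = (\<Sum>g\<in>carrier G. \<rho> g $$ (a, b) * \<rho> (inv g) $$ (c, d))" for a d
  define M where "M = mat n n (\<lambda>(a, d). m a d)"
  have M: "M \<in> carrier_mat n n" by (simp add: M_def)
  have "\<rho> h * M = M * \<rho> h" if h: "h \<in> carrier G" for h
  proof (rule eq_matI)
    fix a d assume "a < dim_row (M * \<rho> h)" "d < dim_col (M * \<rho> h)"
    with h M have ad: "a < n" "d < n" by auto
    have "(\<rho> h * M) $$ (a, d) = (\<Sum>e<n. \<rho> h $$ (a, e) * m e d)"
      using ad h by (simp add: M_def scalar_prod_def lessThan_atLeast0)
    also have "\<dots> = (\<Sum>g\<in>carrier G. (\<Sum>e<n. \<rho> h $$ (a, e) * \<rho> g $$ (e, b)) * \<rho> (inv g) $$ (c, d))"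
      unfolding m_def sum_distrib_left sum_distrib_right mult.assoc by (rule sum.swap)
    also have "\<dots> = (\<Sum>g\<in>carrier G. \<rho> (h \<otimes> g) $$ (a, b) * \<rho> (inv g) $$ (c, d))"
      using ad h b by (intro sum.cong) (auto simp: rep_mult_index)
    \<comment> \<open>Substitution of \<open>h \<otimes> g\<close> by \<open>g\<close> moves
      \<open>h\<close> from the first factor to the second.\<close>
    also have "\<dots> = (\<Sum>g\<in>carrier G. \<rho> g $$ (a, b) * \<rho> (inv g \<otimes> h) $$ (c, d))"
      by (rule sum.reindex_bij_witness[of _ "\<lambda>g. inv h \<otimes> g" "\<lambda>g. h \<otimes> g"])
        (use h in \<open>auto simp: m_assoc[symmetric] inv_mult_group\<close>, simp add: m_assoc)
    also have "\<dots> = (\<Sum>g\<in>carrier G. \<Sum>e<n. \<rho> g $$ (a, b) * \<rho> (inv g) $$ (c, e) * \<rho> h $$ (e, d))"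
      using ad h c by (intro sum.cong) (auto simp: rep_mult_index sum_distrib_left mult.assoc)
    also have "\<dots> = (\<Sum>e<n. m a e * \<rho> h $$ (e, d))"
      unfolding m_def sum_distrib_right by (rule sum.swap)
    also have "\<dots> = (M * \<rho> h) $$ (a, d)"
      using ad h by (simp add: M_def scalar_prod_def lessThan_atLeast0)
    finally show "(\<rho> h * M) $$ (a, d) = (M * \<rho> h) $$ (a, d)" .
  qed (use h M in auto)
  then obtain z where z: "M = z \<cdot>\<^sub>m 1\<^sub>m n" using schur[OF M] by blast
  have m: "m a d = (if a = d then z else 0)" if "a < n" "d < n" for a d
  proof -
    have "M $$ (a, d) = m a d" using that by (simp add: M_def)
    then show ?thesis using that z by (auto split: if_splits)
  qed
  \<comment> \<open>The trace of \<open>M\<close> is evaluated a second time: summing over the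
    diagonal turns each group term into an entry of the matrix of the unit.\<close>
  have "of_nat n * z = (\<Sum>e<n. m e e)" by (simp add: m)
  also have "\<dots> = (\<Sum>g\<in>carrier G. \<Sum>e<n. \<rho> (inv g) $$ (c, e) * \<rho> g $$ (e, b))"
    unfolding m_def by (subst sum.swap) (simp add: mult.commute)
  also have "\<dots> = (\<Sum>g\<in>carrier G. \<rho> \<one> $$ (c, b))"
    using b c by (intro sum.cong) (auto simp: rep_mult_index[symmetric])
  also have "\<dots> = (if b = c then of_nat (Coset.order G) else 0)"
    using b c by (auto simp: rep_one Coset.order_def)
  finally have "z = (if b = c then of_nat (Coset.order G) / of_nat n else 0)"
    using n_pos by (auto simp: field_simps split: if_splits)
  then show ?thesis using m[OF a d] by (simp add: m_def)
qed

end

text \<open>Induction on the truncations of \<open>v\<close> to its first \<open>k\<close>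
  coordinates, each obtained from the previous one by adding a multiple of one unit vector.\<close>

lemma vec_linear_expansion:
  fixes \<Phi> :: "complex vec \<Rightarrow> 'x \<Rightarrow> complex"
  assumes add: "\<And>v w. v \<in> carrier_vec n \<Longrightarrow> w \<in> carrier_vec n \<Longrightarrow> \<Phi> (v + w) = \<Phi> v + \<Phi> w"
    and scale: "\<And>a v. v \<in> carrier_vec n \<Longrightarrow> \<Phi> (a \<cdot>\<^sub>v v) = cscale a (\<Phi> v)"
    and v: "v \<in> carrier_vec n"
  shows "\<Phi> v = (\<Sum>i<n. cscale (v $ i) (\<Phi> (unit_vec n i)))"
proof -
  have "\<Phi> (vec n (\<lambda>i. if i < k then v $ i else 0)) = (\<Sum>i<k. cscale (v $ i) (\<Phi> (unit_vec n i)))"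
    if "k \<le> n" for k
    using that
  proof (induction k)
    case 0
    have "vec n (\<lambda>i. if i < 0 then v $ i else 0) = 0 \<cdot>\<^sub>v 0\<^sub>v n" by (intro eq_vecI) auto
    then show ?case by (simp add: scale fun_eq_iff cscale_def)
  next
    case (Suc k)
    have "vec n (\<lambda>i. if i < Suc k then v $ i else 0) =
        vec n (\<lambda>i. if i < k then v $ i else 0) + v $ k \<cdot>\<^sub>v unit_vec n k"
      using Suc.prems by (intro eq_vecI) (auto simp: less_Suc_eq)
    then show ?case using Suc by (simp add: add scale)
  qed
  moreover have "vec n (\<lambda>i. if i < n then v $ i else 0) = v" using v by (intro eq_vecI) auto
  ultimately show ?thesis by (metis order_refl)
qed

section \<open>Isotypic subspaces\<close>

context symmetric_laplacian begin

lemma clinear_translation: "clinear (T g)"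
  by (rule clinearI) (auto simp: translation_def pullback_def fun_eq_iff)

lemma A_translation: "g \<in> \<Gamma> \<Longrightarrow> u \<in> L2 S \<Longrightarrow> A (T g u) = T g (A u)"
  using invariant by (simp add: invariant_operator_def translation_def)

lemma induced_mem_L2: "induced m w \<in> L2 S"
  by (simp add: induced_def L2_def sum_fun_apply pullback_def)

text \<open>A change of variable in the sum over the group. Right translation mixes the matrix
  coefficients of a fixed row among themselves, which is what \<open>induced_isotypic\<close>
  exploits.\<close>

lemma translation_induced:
  assumes h: "h \<in> \<Gamma>"
  shows "T h (induced m w) = induced (\<lambda>g. m (g \<otimes> h)) w"
proof
  fix y
  show "T h (induced m w) y = induced (\<lambda>g. m (g \<otimes> h)) w y"
  proof (cases "y \<in> S")
    case True
    have "T h (induced m w) y = (\<Sum>g\<in>\<Gamma>. m g * w (\<phi> (g \<otimes> inv h) y))"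
      using True h
      by (simp add: translation_apply induced_def sum_fun_apply pullback_def act_mult)
    also have "\<dots> = (\<Sum>g\<in>\<Gamma>. m (g \<otimes> h) * w (\<phi> g y))"
      by (rule sum.reindex_bij_witness[of _ "\<lambda>g. g \<otimes> h" "\<lambda>g. g \<otimes> inv h"])
        (use h in \<open>auto simp: m_assoc\<close>)
    finally show ?thesis using True by (simp add: induced_def sum_fun_apply pullback_def)
  next
    case False
    then show ?thesis by (simp add: translation_def induced_def sum_fun_apply pullback_def)
  qed
qed

lemma coefficient_system_L2:
  defines "\<delta> \<equiv> \<lambda>g h. if g = h then 1 else 0"
  shows "coefficient_system X \<mu> G \<phi> c F (L2 S) \<Gamma> \<delta> \<delta>"
proof
  fix s t assume "s \<in> \<Gamma>" "t \<in> \<Gamma>"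
  have "(\<Sum>g\<in>\<Gamma>. \<delta> s g * \<delta> t g) = (\<Sum>g\<in>\<Gamma>. if g = s then \<delta> t g else 0)"
    by (intro sum.cong) (auto simp: \<delta>_def)
  then show "(\<Sum>g\<in>\<Gamma>. \<delta> s g * \<delta> t g) = (if s = t then 1 else 0)"
    using finite_G \<open>s \<in> \<Gamma>\<close> by (auto simp: \<delta>_def)
next
  fix u x g assume "g \<in> \<Gamma>"
  have "(\<Sum>h\<in>\<Gamma>. \<delta> s h * u (\<phi> (inv h) x)) = u (\<phi> (inv s) x)" if "s \<in> \<Gamma>" for s
  proof -
    have "(\<Sum>h\<in>\<Gamma>. \<delta> s h * u (\<phi> (inv h) x)) = (\<Sum>h\<in>\<Gamma>. if h = s then u (\<phi> (inv h) x) else 0)"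
      by (intro sum.cong) (auto simp: \<delta>_def)
    then show ?thesis using finite_G that by simp
  qed
  then have "(\<Sum>s\<in>\<Gamma>. \<delta> s g * (\<Sum>h\<in>\<Gamma>. \<delta> s h * u (\<phi> (inv h) x))) =
      (\<Sum>s\<in>\<Gamma>. if s = g then u (\<phi> (inv s) x) else 0)"
    by (intro sum.cong) (auto simp: \<delta>_def)
  then show "u (\<phi> (inv g) x) = (\<Sum>s\<in>\<Gamma>. \<delta> s g * (\<Sum>h\<in>\<Gamma>. \<delta> s h * u (\<phi> (inv h) x)))"
    using finite_G \<open>g \<in> \<Gamma>\<close> by simp
qed (use A_in_L2 finite_G induced_mem_L2 subspace_L2 in auto)

end

section \<open>Matrix coefficients and the isotypic subspace\<close>

locale irrep_laplacian = symmetric_laplacian X \<mu> G \<phi> c F + unitary_irrep G n \<rho>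
  for X :: "'x pair_pre_digraph" and \<mu> and G :: "('g, 'b) monoid_scheme" (structure)
    and \<phi> c F n \<rho>
begin

abbreviation "isotypic \<equiv> isotypic_subspace G S \<phi> n \<rho>"

text \<open>The isotypic subspace is a span of copies of the representation, so a property stable
  under linear combinations need only be checked on values of equivariant linear maps.\<close>

lemma isotypic_induct:
  assumes u: "u \<in> isotypic" and P: "cfun.subspace {u. P u}"
    and gen: "\<And>\<Phi> v. (\<And>v w. v \<in> carrier_vec n \<Longrightarrow> w \<in> carrier_vec n \<Longrightarrow> \<Phi> (v + w) = \<Phi> v + \<Phi> w)
      \<Longrightarrow> (\<And>a v. v \<in> carrier_vec n \<Longrightarrow> \<Phi> (a \<cdot>\<^sub>v v) = cscale a (\<Phi> v))
      \<Longrightarrow> (\<And>g v. g \<in> \<Gamma> \<Longrightarrow> v \<in> carrier_vec n \<Longrightarrow> \<Phi> (\<rho> g *\<^sub>v v) = T g (\<Phi> v))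
      \<Longrightarrow> (\<And>v. v \<in> carrier_vec n \<Longrightarrow> \<Phi> v \<in> L2 S)
      \<Longrightarrow> v \<in> carrier_vec n \<Longrightarrow> P (\<Phi> v)"
  shows "P u"
proof -
  have "isotypic \<subseteq> {u. P u}"
    unfolding isotypic_subspace_def
  proof (rule cfun.span_minimal[OF _ P], clarify)
    fix w W assume w: "w \<in> W" and W: "W \<subseteq> L2 S" and "transforms_according_to G S \<phi> W n \<rho>"
    then obtain \<Phi> where \<Phi>: "bij_betw \<Phi> (carrier_vec n) W"
      "\<forall>v\<in>carrier_vec n. \<forall>w\<in>carrier_vec n. \<Phi> (v + w) = \<Phi> v + \<Phi> w"
      "\<forall>a. \<forall>v\<in>carrier_vec n. \<Phi> (a \<cdot>\<^sub>v v) = cscale a (\<Phi> v)"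
      "\<forall>g\<in>\<Gamma>. \<forall>v\<in>carrier_vec n. \<Phi> (\<rho> g *\<^sub>v v) = T g (\<Phi> v)"
      unfolding transforms_according_to_def by blast
    then obtain v where v: "v \<in> carrier_vec n" "w = \<Phi> v" using w by (auto simp: bij_betw_def)
    have "\<Phi> v \<in> L2 S" if "v \<in> carrier_vec n" for v
      using \<Phi>(1) W that by (auto simp: bij_betw_def)
    with gen[of \<Phi> v] \<Phi> v show "P w" by blast
  qed
  with u show ?thesis by blast
qed

text \<open>The kernel of \<open>\<Psi>\<close> is an invariant subspace, so \<open>\<Psi>\<close>
  is zero or injective; if injective, its image is one of the generating copies. As injectivity is
  not demanded, the lemma applies to maps such as the composition of \<open>A\<close> with an
  embedding.\<close>

lemma equivariant_image_isotypic:
  assumes add: "\<And>v w. v \<in> carrier_vec n \<Longrightarrow> w \<in> carrier_vec n \<Longrightarrow> \<Psi> (v + w) = \<Psi> v + \<Psi> w"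
    and scale: "\<And>a v. v \<in> carrier_vec n \<Longrightarrow> \<Psi> (a \<cdot>\<^sub>v v) = cscale a (\<Psi> v)"
    and equi: "\<And>g v. g \<in> \<Gamma> \<Longrightarrow> v \<in> carrier_vec n \<Longrightarrow> \<Psi> (\<rho> g *\<^sub>v v) = T g (\<Psi> v)"
    and L2: "\<And>v. v \<in> carrier_vec n \<Longrightarrow> \<Psi> v \<in> L2 S"
    and v: "v \<in> carrier_vec n"
  shows "\<Psi> v \<in> isotypic"
proof -
  have "0 \<cdot>\<^sub>v 0\<^sub>v n = (0\<^sub>v n :: complex vec)" by auto
  then have zero: "\<Psi> (0\<^sub>v n) = 0" using scale[of "0\<^sub>v n" 0] by (simp add: cscale_def fun_eq_iff)
  define K where "K = {v \<in> carrier_vec n. \<Psi> v = 0}"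
  have "K = {0\<^sub>v n} \<or> K = carrier_vec n"
    by (rule irreducible_cases)
      (auto simp: K_def zero add scale equi clinear_zero[OF clinear_translation] simp del: zero_fun_def
        intro: mult_mat_vec_carrier[OF rep_carrier])
  then show ?thesis
  proof
    assume "K = carrier_vec n"
    then have "\<Psi> v = 0" using v by (auto simp: K_def)
    then show ?thesis unfolding isotypic_subspace_def by (simp add: cfun.span_zero del: zero_fun_def)
  next
    assume K: "K = {0\<^sub>v n}"
    define W where "W = \<Psi> ` carrier_vec n"
    have "inj_on \<Psi> (carrier_vec n)"
    proof (rule inj_onI)
      fix v w assume vw: "v \<in> carrier_vec n" "w \<in> carrier_vec n" "\<Psi> v = \<Psi> w"
      have "\<Psi> (v + (-1) \<cdot>\<^sub>v w) = 0" using vw by (simp add: add scale fun_eq_iff)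
      then have "v + (-1) \<cdot>\<^sub>v w \<in> K" using vw by (simp add: K_def)
      then have *: "v + (-1) \<cdot>\<^sub>v w = 0\<^sub>v n" using K by simp
      show "v = w"
      proof (rule eq_vecI)
        fix i assume i: "i < dim_vec w"
        have "(v + (-1) \<cdot>\<^sub>v w) $ i = 0\<^sub>v n $ i" unfolding * ..
        then show "v $ i = w $ i" using i vw by auto
      qed (use vw in auto)
    qed
    then have "transforms_according_to G S \<phi> W n \<rho>"
      unfolding transforms_according_to_def using add scale equi
      by (intro exI[of _ \<Psi>]) (auto simp: bij_betw_def W_def)
    moreover have "cfun.subspace W"
      unfolding cfun.subspace_def W_def
    proof (intro conjI ballI allI)
      show "0 \<in> \<Psi> ` carrier_vec n" using zero zero_carrier_vec by (metis imageI)
    next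
      fix x y assume "x \<in> \<Psi> ` carrier_vec n" "y \<in> \<Psi> ` carrier_vec n"
      then obtain v w where "v \<in> carrier_vec n" "w \<in> carrier_vec n" "x = \<Psi> v" "y = \<Psi> w" by blast
      then show "x + y \<in> \<Psi> ` carrier_vec n" by (intro image_eqI[of _ _ "v + w"]) (simp_all add: add)
    next
      fix a x assume "x \<in> \<Psi> ` carrier_vec n"
      then obtain v where "v \<in> carrier_vec n" "x = \<Psi> v" by blast
      then show "cscale a x \<in> \<Psi> ` carrier_vec n" by (intro image_eqI[of _ _ "a \<cdot>\<^sub>v v"]) (simp_all add: scale)
    qed
    moreover have "T g ` W \<subseteq> W" if "g \<in> \<Gamma>" for g
    proof clarify
      fix w assume "w \<in> W"
      then obtain v where "v \<in> carrier_vec n" "w = \<Psi> v" by (auto simp: W_def)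
      then show "T g w \<in> W"
        using equi[OF that] mult_mat_vec_carrier[OF rep_carrier[OF that]] by (metis W_def imageI)
    qed
    moreover have "W \<subseteq> L2 S" using L2 by (auto simp: W_def)
    ultimately show ?thesis
      unfolding isotypic_subspace_def using v
      by (intro cfun.span_base UnionI[of W]) (auto simp: W_def)
  qed
qed

lemma subspace_isotypic: "cfun.subspace isotypic"
  unfolding isotypic_subspace_def by (rule cfun.subspace_span)

lemma isotypic_sub: "isotypic \<subseteq> L2 S"
proof
  fix u assume "u \<in> isotypic"
  then show "u \<in> L2 S"
    by (rule isotypic_induct) (use subspace_L2 in auto)
qed

lemma A_isotypic: "u \<in> isotypic \<Longrightarrow> A u \<in> isotypic"
proof (erule isotypic_induct)
  show "cfun.subspace {u. A u \<in> isotypic}"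
    using subspace_isotypic
    by (auto simp: cfun.subspace_def clinear_add[OF clinear_A] clinear_scale[OF clinear_A]
        clinear_zero[OF clinear_A] simp del: zero_fun_def)
next
  fix \<Phi> :: "complex vec \<Rightarrow> 'x \<Rightarrow> complex" and v :: "complex vec"
  assume \<Phi>: "\<And>v w. v \<in> carrier_vec n \<Longrightarrow> w \<in> carrier_vec n \<Longrightarrow> \<Phi> (v + w) = \<Phi> v + \<Phi> w"
    "\<And>a v. v \<in> carrier_vec n \<Longrightarrow> \<Phi> (a \<cdot>\<^sub>v v) = cscale a (\<Phi> v)"
    "\<And>g v. g \<in> \<Gamma> \<Longrightarrow> v \<in> carrier_vec n \<Longrightarrow> \<Phi> (\<rho> g *\<^sub>v v) = T g (\<Phi> v)"
    "\<And>v. v \<in> carrier_vec n \<Longrightarrow> \<Phi> v \<in> L2 S" "v \<in> carrier_vec n"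
  show "A (\<Phi> v) \<in> isotypic"
    by (rule equivariant_image_isotypic[of "\<lambda>v. A (\<Phi> v)"])
      (simp_all add: \<Phi> clinear_add[OF clinear_A] clinear_scale[OF clinear_A] A_translation A_in_L2
        del: plus_fun_def)
qed

definition matrix_coeff :: "nat \<times> nat \<Rightarrow> 'g \<Rightarrow> complex" where
  "matrix_coeff s g = \<rho> g $$ s"

text \<open>The swapped indices, the inverse and the factor are those that turn
  \<open>schur_orthogonality\<close> into biorthogonality with \<open>matrix_coeff\<close>.\<close>

definition dual_coeff :: "nat \<times> nat \<Rightarrow> 'g \<Rightarrow> complex" where
  "dual_coeff s g = of_nat n / of_nat (Coset.order G) * \<rho> (inv g) $$ (snd s, fst s)"

lemma order_pos: "Coset.order G > 0"
  using finite_G order_gt_0_iff_finite by simp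

lemma dual_matrix_coeff:
  assumes "s \<in> {..<n} \<times> {..<n}" "t \<in> {..<n} \<times> {..<n}"
  shows "(\<Sum>g\<in>\<Gamma>. dual_coeff s g * matrix_coeff t g) = (if s = t then 1 else 0)"
proof -
  obtain a b a' b' where st: "s = (a, b)" "t = (a', b')" by (cases s, cases t)
  have "(\<Sum>g\<in>\<Gamma>. dual_coeff s g * matrix_coeff t g) =
      of_nat n / of_nat (Coset.order G) * (\<Sum>g\<in>\<Gamma>. \<rho> g $$ (a', b') * \<rho> (inv g) $$ (b, a))"
    by (simp add: st matrix_coeff_def dual_coeff_def sum_distrib_left mult_ac)
  also have "\<dots> = (if s = t then 1 else 0)"
    using assms n_pos order_pos by (subst schur_orthogonality) (auto simp: st)
  finally show ?thesis .
qed

text \<open>For \<open>u = \<Phi> v\<close> the value at \<open>\<phi> (inv g) x\<close> is that of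
  \<open>\<Phi> (\<rho> g *\<^sub>v v)\<close> at \<open>x\<close>, a combination of matrix
  coefficients of \<open>g\<close>. Biorthogonality recovers its coefficients.\<close>

lemma isotypic_reproducing:
  assumes u: "u \<in> isotypic" and x: "x \<in> S" and g: "g \<in> \<Gamma>"
  shows "u (\<phi> (inv g) x) = (\<Sum>s\<in>{..<n} \<times> {..<n}. matrix_coeff s g *
    (\<Sum>h\<in>\<Gamma>. dual_coeff s h * u (\<phi> (inv h) x)))"
  using u
proof (rule isotypic_induct)
  show "cfun.subspace {u. u (\<phi> (inv g) x) = (\<Sum>s\<in>{..<n} \<times> {..<n}. matrix_coeff s g *
    (\<Sum>h\<in>\<Gamma>. dual_coeff s h * u (\<phi> (inv h) x)))}"
    by (auto simp: cfun.subspace_def algebra_simps sum.distrib sum_distrib_left)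
next
  fix \<Phi> :: "complex vec \<Rightarrow> 'x \<Rightarrow> complex" and v :: "complex vec"
  assume \<Phi>: "\<And>v w. v \<in> carrier_vec n \<Longrightarrow> w \<in> carrier_vec n \<Longrightarrow> \<Phi> (v + w) = \<Phi> v + \<Phi> w"
    "\<And>a v. v \<in> carrier_vec n \<Longrightarrow> \<Phi> (a \<cdot>\<^sub>v v) = cscale a (\<Phi> v)"
    "\<And>g v. g \<in> \<Gamma> \<Longrightarrow> v \<in> carrier_vec n \<Longrightarrow> \<Phi> (\<rho> g *\<^sub>v v) = T g (\<Phi> v)"
    and v: "v \<in> carrier_vec n"
  let ?Q = "{..<n} \<times> {..<n}"
  \<comment> \<open>These are the coefficients of that combination, obtained by expanding
    \<open>\<rho> g *\<^sub>v v\<close> in unit vectors; they do not depend on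
    \<open>g\<close>.\<close>
  define y where "y = (\<lambda>(a, b). v $ b * \<Phi> (unit_vec n a) x)"
  have expand: "\<Phi> v (\<phi> (inv h) x) = (\<Sum>s\<in>?Q. matrix_coeff s h * y s)" if h: "h \<in> \<Gamma>" for h
  proof -
    have "\<Phi> v (\<phi> (inv h) x) = \<Phi> (\<rho> h *\<^sub>v v) x"
      using h x v by (simp add: \<Phi>(3) translation_apply)
    also have "\<dots> = (\<Sum>a<n. (\<rho> h *\<^sub>v v) $ a * \<Phi> (unit_vec n a) x)"
      using vec_linear_expansion[of n \<Phi>, OF \<Phi>(1,2) mult_mat_vec_carrier[OF rep_carrier[OF h] v]]
      by (simp add: sum_fun_apply)
    also have "\<dots> = (\<Sum>a<n. \<Sum>b<n. matrix_coeff (a, b) h * y (a, b))"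
      using h v by (intro sum.cong)
        (auto simp: rep_mult_vec_index sum_distrib_right sum_distrib_left matrix_coeff_def y_def mult_ac
          simp del: index_mult_mat_vec)
    finally show ?thesis by (simp add: sum.cartesian_product)
  qed
  have "(\<Sum>h\<in>\<Gamma>. dual_coeff s h * \<Phi> v (\<phi> (inv h) x)) = y s" if s: "s \<in> ?Q" for s
  proof -
    have "(\<Sum>h\<in>\<Gamma>. dual_coeff s h * \<Phi> v (\<phi> (inv h) x)) =
        (\<Sum>h\<in>\<Gamma>. \<Sum>t\<in>?Q. dual_coeff s h * matrix_coeff t h * y t)"
      by (intro sum.cong) (auto simp: expand sum_distrib_left mult.assoc)
    also have "\<dots> = (\<Sum>t\<in>?Q. (\<Sum>h\<in>\<Gamma>. dual_coeff s h * matrix_coeff t h) * y t)"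
      unfolding sum_distrib_right by (rule sum.swap)
    also have "\<dots> = (\<Sum>t\<in>?Q. if s = t then y t else 0)"
      using s by (intro sum.cong refl) (simp add: dual_matrix_coeff)
    also have "\<dots> = y s" using s by (subst sum.delta') auto
    finally show ?thesis .
  qed
  then show "\<Phi> v (\<phi> (inv g) x) = (\<Sum>s\<in>?Q. matrix_coeff s g *
    (\<Sum>h\<in>\<Gamma>. dual_coeff s h * \<Phi> v (\<phi> (inv h) x)))"
    unfolding expand[OF g] by (intro sum.cong) auto
qed

text \<open>For a fixed row \<open>a\<close> the functions \<open>I b\<close> transform under
  translation as the unit vectors do under \<open>\<rho>\<close>. Sending unit vectors to them
  therefore defines an equivariant map, to which \<open>equivariant_image_isotypic\<close>
  applies.\<close>

lemma induced_isotypic: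
  assumes a: "a < n" and b: "b < n"
  shows "induced (matrix_coeff (a, b)) w \<in> isotypic"
proof -
  define I where "I b = induced (matrix_coeff (a, b)) w" for b
  define \<Psi> where "\<Psi> v = (\<Sum>b<n. cscale (v $ b) (I b))" for v :: "complex vec"
  have TI: "T h (I b) = (\<Sum>e<n. cscale (\<rho> h $$ (e, b)) (I e))" if h: "h \<in> \<Gamma>" and b: "b < n" for h b
  proof -
    have "T h (I b) = (\<Sum>g\<in>\<Gamma>. cscale (\<Sum>e<n. \<rho> g $$ (a, e) * \<rho> h $$ (e, b)) (pullback S \<phi> g w))"
      unfolding I_def translation_induced[OF h] unfolding induced_def
      using h a b by (intro sum.cong) (auto simp: matrix_coeff_def rep_mult_index)
    also have "\<dots> = (\<Sum>g\<in>\<Gamma>. \<Sum>e<n. cscale (\<rho> h $$ (e, b)) (cscale (\<rho> g $$ (a, e)) (pullback S \<phi> g w)))"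
      by (simp add: cfun.scale_sum_left mult.commute)
    also have "\<dots> = (\<Sum>e<n. cscale (\<rho> h $$ (e, b)) (I e))"
      unfolding I_def induced_def cfun.scale_sum_right matrix_coeff_def by (rule sum.swap)
    finally show ?thesis .
  qed
  have "\<Psi> (unit_vec n b) \<in> isotypic"
  proof (rule equivariant_image_isotypic)
    fix v w :: "complex vec" assume "v \<in> carrier_vec n" "w \<in> carrier_vec n"
    then show "\<Psi> (v + w) = \<Psi> v + \<Psi> w"
      by (simp add: \<Psi>_def cfun.scale_left_distrib sum.distrib del: plus_fun_def)
  next
    fix k and v :: "complex vec" assume "v \<in> carrier_vec n"
    then show "\<Psi> (k \<cdot>\<^sub>v v) = cscale k (\<Psi> v)"
      by (simp add: \<Psi>_def cfun.scale_sum_right)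
  next
    fix h and v :: "complex vec" assume h: "h \<in> \<Gamma>" and v: "v \<in> carrier_vec n"
    have "\<Psi> (\<rho> h *\<^sub>v v) = (\<Sum>e<n. cscale (\<Sum>b<n. \<rho> h $$ (e, b) * v $ b) (I e))"
      unfolding \<Psi>_def using h v by (intro sum.cong) (auto simp: rep_mult_vec_index simp del: index_mult_mat_vec)
    also have "\<dots> = (\<Sum>e<n. \<Sum>b<n. cscale (v $ b) (cscale (\<rho> h $$ (e, b)) (I e)))"
      by (simp add: cfun.scale_sum_left mult.commute)
    also have "\<dots> = (\<Sum>b<n. \<Sum>e<n. cscale (v $ b) (cscale (\<rho> h $$ (e, b)) (I e)))"
      by (rule sum.swap)
    also have "\<dots> = (\<Sum>b<n. cscale (v $ b) (T h (I b)))"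
      using h by (intro sum.cong) (auto simp: TI cfun.scale_sum_right)
    also have "\<dots> = T h (\<Psi> v)"
      by (simp only: \<Psi>_def clinear_sum[OF clinear_translation] clinear_scale[OF clinear_translation])
    finally show "\<Psi> (\<rho> h *\<^sub>v v) = T h (\<Psi> v)" .
  next
    fix v :: "complex vec"
    show "\<Psi> v \<in> L2 S" unfolding \<Psi>_def I_def
      by (intro cfun.subspace_sum cfun.subspace_scale subspace_L2 induced_mem_L2)
  qed simp
  also have "\<Psi> (unit_vec n b) = (\<Sum>e<n. if e = b then I e else 0)"
    unfolding \<Psi>_def using b by (intro sum.cong) (auto simp: fun_eq_iff)
  also have "\<dots> = I b" using b by (subst sum.delta) auto
  finally show ?thesis by (simp add: I_def)
qed

lemma coefficient_system_isotypic:
  "coefficient_system X \<mu> G \<phi> c F isotypic ({..<n} \<times> {..<n}) matrix_coeff dual_coeff"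
proof
  show "A ` isotypic \<subseteq> isotypic" using A_isotypic by blast
  show "induced (matrix_coeff s) w \<in> isotypic" if "s \<in> {..<n} \<times> {..<n}" for s w
    using that induced_isotypic by auto
  show "u (\<phi> (inv g) x) = (\<Sum>s\<in>{..<n} \<times> {..<n}. matrix_coeff s g *
      (\<Sum>h\<in>\<Gamma>. dual_coeff s h * u (\<phi> (inv h) x)))"
    if "u \<in> isotypic" "x \<in> S" "g \<in> \<Gamma>" for u x g
    using that by (rule isotypic_reproducing)
qed (simp_all add: subspace_isotypic isotypic_sub dual_matrix_coeff)

end

section \<open>Comparison of the isotypic spectral mass with the full one\<close>

theorem lemma5p1:
  fixes X :: "'x pair_pre_digraph"
    and \<mu> :: "'x \<Rightarrow> real"
    and G :: "('g, 'b) monoid_scheme"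
    and \<phi> :: "'g \<Rightarrow> 'x \<Rightarrow> 'x"
    and c :: "'x \<Rightarrow> 'x \<Rightarrow> real"
    and A :: "('x \<Rightarrow> complex) \<Rightarrow> 'x \<Rightarrow> complex"
    and J :: "'j set"
    and d :: "'j \<Rightarrow> nat"
    and \<pi> :: "'j \<Rightarrow> 'g \<Rightarrow> complex mat"
    and F :: "'x set"
    and j :: 'j
    and lam :: real
  assumes "pair_graph X"
    and "\<And>x. x \<in> pverts X \<Longrightarrow> \<mu> x > 0"
    and "group G" and "finite (carrier G)"
    and "group_action G (pverts X) \<phi>"
    and "preserves_graph G X \<phi>"
    and "preserves_measure G (pverts X) \<phi> \<mu>"
    and "\<And>x y. (x, y) \<in> parcs X \<Longrightarrow> c x y > 0"
    and "\<And>x y. (x, y) \<in> parcs X \<Longrightarrow> c x y = c y x"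
    and "A = graph_laplacian X \<mu> c"
    and "invariant_operator G (pverts X) \<phi> A"
    and "nonnegative_on_L2 (pverts X) \<mu> A"
    and "self_adjoint_on_L2 (pverts X) \<mu> A"
    and "complete_irreps G J d \<pi>"
    and "fundamental_domain G (pverts X) \<phi> F"
    and "j \<in> J"
  shows "\<bar>spectral_mass (pverts X) \<mu> A (isotypic_subspace G (pverts X) \<phi> (d j) (\<pi> j)) lam
           - (real (d j))^2 / real (Coset.order G) * spectral_mass (pverts X) \<mu> A (L2 (pverts X)) lam\<bar>
         \<le> (real (d j))^2 * real (card (domain_boundary G X \<phi> F)) / (\<Sum>x\<in>pverts X. \<mu> x)"

proof -
  interpret symmetric_laplacian X \<mu> G \<phi> c F
    using assms by (simp_all add: symmetric_laplacian_def)
  have rep: "unitary_rep G (d j) (\<pi> j)" "irreducible_rep G (d j) (\<pi> j)"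
    using \<open>complete_irreps G J d \<pi>\<close> \<open>j \<in> J\<close> by (auto simp: complete_irreps_def)
  interpret irrep_laplacian X \<mu> G \<phi> c F "d j" "\<pi> j"
    using rep finite_G by unfold_locales
  interpret L2: coefficient_system X \<mu> G \<phi> c F "L2 (pverts X)" "carrier G"
      "\<lambda>g h. if g = h then 1 else 0" "\<lambda>g h. if g = h then 1 else 0"
    by (rule coefficient_system_L2)
  interpret iso: coefficient_system X \<mu> G \<phi> c F
      "isotypic_subspace G (pverts X) \<phi> (d j) (\<pi> j)" "{..<d j} \<times> {..<d j}"
      matrix_coeff dual_coeff
    by (rule coefficient_system_isotypic)
  define k b o' where "k = real (dirichlet_count lam)" and "b = real (card (domain_boundary G X \<phi> F))"
    and "o' = real (Coset.order G)"
  define N N' where "N = real (eigenvalue_count (graph_laplacian X \<mu> c) (L2 (pverts X)) lam)"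
    and "N' = real (eigenvalue_count (graph_laplacian X \<mu> c)
      (isotypic_subspace G (pverts X) \<phi> (d j) (\<pi> j)) lam)"
  let ?m = "\<Sum>x\<in>pverts X. \<mu> x"
  let ?D = "(real (d j))\<^sup>2"
  have o': "o' > 0" using order_pos by (simp add: o'_def)
  have "o' * k \<le> N" "N \<le> o' * (k + b)"
    using L2.eigenvalue_count_ge[of lam] L2.eigenvalue_count_le[of lam]
    unfolding o'_def k_def b_def N_def Coset.order_def of_nat_mult[symmetric] of_nat_add[symmetric] of_nat_le_iff
    by auto
  then have "k \<le> N / o'" "N / o' \<le> k + b" using o' by (simp_all add: field_simps)
  then have "?D * k \<le> ?D * (N / o')" "?D * (N / o') \<le> ?D * (k + b)"
    by (simp_all only: mult_left_mono zero_le_power2)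
  moreover have "?D * k \<le> N'" "N' \<le> ?D * (k + b)"
    using iso.eigenvalue_count_ge[of lam] iso.eigenvalue_count_le[of lam]
    unfolding k_def b_def N'_def power2_eq_square of_nat_mult[symmetric] of_nat_add[symmetric] of_nat_le_iff
    by (simp_all add: card_cartesian_product)
  \<comment> \<open>Both \<open>N'\<close> and \<open>?D * (N / o')\<close> lie in the interval from
    \<open>?D * k\<close> to \<open>?D * (k + b)\<close>, whose length is the claimed error before
    division by the total mass.\<close>
  ultimately have "\<bar>N' - ?D * (N / o')\<bar> \<le> ?D * b" by (simp add: distrib_left)
  moreover have "?m \<ge> 0" using weight_pos by (intro sum_nonneg less_imp_le)
  ultimately have "\<bar>N' - ?D * (N / o')\<bar> / ?m \<le> ?D * b / ?m" by (rule divide_right_mono)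
  moreover have "N' / ?m - ?D / o' * (N / ?m) = (N' - ?D * (N / o')) / ?m"
    by (simp add: diff_divide_distrib mult.commute)
  then have "\<bar>N' / ?m - ?D / o' * (N / ?m)\<bar> = \<bar>N' - ?D * (N / o')\<bar> / ?m"
    by (simp only: abs_divide abs_of_nonneg[OF \<open>?m \<ge> 0\<close>])
  ultimately show ?thesis
    unfolding spectral_mass_def \<open>A = graph_laplacian X \<mu> c\<close> N_def N'_def o'_def b_def by simp
qed

end
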